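(* Let $T,D,a\in\mathbb{R}$ with $a^2+D^2\neq 0$, let $W(y)=Dy^2-aTy+a^2$, and let $P:I\to(-\infty,0]$ be the left Poincaré half-map of the system $\dot x=Tx-y$, $\dot y=Dx-a$ associated to $\Sigma=\{x=0\}$. Assume that there exists a value $\hat y_0>0$ with $P(\hat y_0)=0$. Then $a<0$, $T<0$, $4D-T^2>0$, $\hat y_0$ is the left endpoint of the interval $I$, the inverse function $P^{-1}$ is a real analytic function, and $P$ admits the Newton–Puiseux series expansion around the point $\hat y_0$ given by $$ \begin{aligned} P(y_0)={}&a\sqrt{\frac{2\hat y_0}{W(\hat y_0)}}\,(y_0-\hat y_0)^{1/2}-\frac{aT}{3}\,\frac{2\hat y_0}{W(\hat y_0)}\,(y_0-\hat y_0)\\ &+\frac{a^3}{72}\left(\frac{9D+2T^2}{a^2}+\frac{9}{\hat y_0^2}\right)\left(\sqrt{\frac{2\hat y_0}{W(\hat y_0)}}\right)^3(y_0-\hat y_0)^{3/2}+\mathcal{O}\left((y_0-\hat y_0)^2\right), \end{aligned} $$ which is valid for $y_0\geqslant\hat y_0$.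
   Context: Let $T,D,a\in\mathbb{R}$ with $a^2+D^2\neq0$ (standing assumption) and consider the planar linear system $\dot x=Tx-y$, $\dot y=Dx-a$, with Poincaré section $\Sigma=\{(x,y)\in\mathbb{R}^2:x=0\}$. Left Poincaré half-map $P$: for $y_0\geqslant0$ let $\Phi(t;y_0)=(\Phi_1(t;y_0),\Phi_2(t;y_0))$ be the solution with $\Phi(0;y_0)=(0,y_0)$. If there exists $\tau(y_0)>0$ such that $\Phi_1(\tau(y_0);y_0)=0$ and $\Phi_1(t;y_0)<0$ for every $t\in(0,\tau(y_0))$, put $P(y_0)=\Phi_2(\tau(y_0);y_0)\leqslant0$. If $P(0)$ is not defined by this rule, but for every $\varepsilon>0$ there exist $y_0\in(0,\varepsilon)$ and $y_1\in(-\varepsilon,0)$ with $P(y_0)=y_1$, then $P$ is extended continuously by $P(0)=0$. The domain of $P$ is the interval $I\subset[0,+\infty)$ of all $y_0$ where $P$ is so defined. The inverse function is $P^{-1}:P(I)\to I$; real analyticity at an endpoint belonging to the domain means coincidence near that point with a function real analytic in a neighbourhood of it. The Newton–Puiseux series expansion of $P$ around $\hat y_0$ is an expansion in powers of $(y_0-\hat y_0)^{1/2}$; it amounts to the Taylor expansion around $z_0=0$ of $Q(z_0)=P(\hat y_0+z_0^2)$ (for $z_0\geqslant0$), followed by the substitution $z_0=\sqrt{y_0-\hat y_0}$. *)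

theory Defs
  imports "HOL-Analysis.Analysis" "HOL-Library.Landau_Symbols"
begin

definition is_solution :: "real \<Rightarrow> real \<Rightarrow> real \<Rightarrow> real \<Rightarrow> (real \<Rightarrow> real \<times> real) \<Rightarrow> bool" where
  "is_solution T D a y\<^sub>0 \<Phi> \<longleftrightarrow>
     \<Phi> 0 = (0, y\<^sub>0) \<and>
     (\<forall>t. (\<Phi> has_vector_derivative (T * fst (\<Phi> t) - snd (\<Phi> t), D * fst (\<Phi> t) - a)) (at t))"

(* The initial value problem is linear, so the global solution exists and is unique;
   the existential quantifier over \<Phi> just introduces a name for it. *)
definition left_return :: "real \<Rightarrow> real \<Rightarrow> real \<Rightarrow> real \<Rightarrow> real \<Rightarrow> bool" where
  "left_return T D a y\<^sub>0 y\<^sub>1 \<longleftrightarrow>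
     y\<^sub>0 \<ge> 0 \<and>
     (\<exists>\<Phi> \<tau>. is_solution T D a y\<^sub>0 \<Phi> \<and> \<tau> > 0 \<and> fst (\<Phi> \<tau>) = 0 \<and>
        (\<forall>t\<in>{0<..<\<tau>}. fst (\<Phi> t) < 0) \<and> snd (\<Phi> \<tau>) = y\<^sub>1)"

definition left_poincare_graph :: "real \<Rightarrow> real \<Rightarrow> real \<Rightarrow> real \<Rightarrow> real \<Rightarrow> bool" where
  "left_poincare_graph T D a y\<^sub>0 y\<^sub>1 \<longleftrightarrow>
     left_return T D a y\<^sub>0 y\<^sub>1 \<or>
     (y\<^sub>0 = 0 \<and> y\<^sub>1 = 0 \<and> \<not> (\<exists>y. left_return T D a 0 y) \<and>
      (\<forall>\<epsilon>>0. \<exists>u\<in>{0<..<\<epsilon>}. \<exists>v\<in>{-\<epsilon><..<0}. left_return T D a u v))"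

definition left_poincare_dom :: "real \<Rightarrow> real \<Rightarrow> real \<Rightarrow> real set" where
  "left_poincare_dom T D a = {y\<^sub>0. \<exists>y\<^sub>1. left_poincare_graph T D a y\<^sub>0 y\<^sub>1}"

(* Meaningful only on left_poincare_dom T D a. *)
definition left_poincare_map :: "real \<Rightarrow> real \<Rightarrow> real \<Rightarrow> real \<Rightarrow> real" where
  "left_poincare_map T D a y\<^sub>0 = (THE y\<^sub>1. left_poincare_graph T D a y\<^sub>0 y\<^sub>1)"

definition W :: "real \<Rightarrow> real \<Rightarrow> real \<Rightarrow> real \<Rightarrow> real" where
  "W T D a y = D * y\<^sup>2 - a * T * y + a\<^sup>2"

definition real_analytic_at :: "(real \<Rightarrow> real) \<Rightarrow> real \<Rightarrow> bool" where
  "real_analytic_at g x \<longleftrightarrow>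
     (\<exists>c. \<exists>r>0. \<forall>u. \<bar>u - x\<bar> < r \<longrightarrow> (\<lambda>n. c n * (u - x) ^ n) sums g u)"

(* S need not be open: at a point of S the function has to agree, on S, with a
   function that is real analytic in a full neighbourhood of that point. *)
definition real_analytic_on :: "(real \<Rightarrow> real) \<Rightarrow> real set \<Rightarrow> bool" where
  "real_analytic_on f S \<longleftrightarrow>
     (\<forall>x\<in>S. \<exists>U g. open U \<and> x \<in> U \<and> (\<forall>u\<in>U. real_analytic_at g u) \<and> (\<forall>u\<in>S \<inter> U. f u = g u))"

(* One-sided convergent expansion of f, defined on S, in powers of (y - p) powr (1/2);
   equivalently z \<mapsto> f (p + z\<^sup>2) is, for small z \<ge> 0, the sum of the power series
   with coefficients c. *)
definition has_newton_puiseux_half ::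
    "(real \<Rightarrow> real) \<Rightarrow> real set \<Rightarrow> real \<Rightarrow> (nat \<Rightarrow> real) \<Rightarrow> bool" where
  "has_newton_puiseux_half f S p c \<longleftrightarrow>
     (\<exists>r>0. {p..<p + r} \<subseteq> S \<and>
        (\<forall>y\<in>{p..<p + r}. (\<lambda>n. c n * sqrt (y - p) ^ n) sums f y))"

end

theory Submission
  imports Defs "HOL-Complex_Analysis.Complex_Analysis"
begin

text \<open>
  The sign conditions are read off the orbit that ends at the origin: \<open>x'' = a\<close> there, the energy
  \<open>x'\<^sup>2 / 2 + D x\<^sup>2 / 2 - a x\<close> has derivative \<open>T x'\<^sup>2\<close>, and with real eigenvalues \<open>x'\<close> could vanish only once.
  For a focus, the half-map is parametrized by the time of flight: both end points of a half-turn are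
  explicit functions \<open>y\<^sub>0(t)\<close>, \<open>y\<^sub>1(t)\<close>, holomorphic in \<open>t\<close>, with \<open>y\<^sub>1\<close> strictly increasing and \<open>y\<^sub>0\<close> strictly
  decreasing until the time \<open>\<theta>\<close> at which the origin is hit, where \<open>y\<^sub>0'\<close> has a simple zero.
  So \<open>P\<^sup>-\<^sup>1 = y\<^sub>0 \<circ> y\<^sub>1\<^sup>-\<^sup>1\<close> is analytic, while inverting a holomorphic square root of
  \<open>y\<^sub>0 - y\<^sub>0(\<theta>)\<close> gives the expansion of \<open>Q(z) = P(y\<^sub>0(\<theta>) + z\<^sup>2)\<close>. The relation
  \<open>y\<^sub>1 y\<^sub>1' W(y\<^sub>0) = y\<^sub>0 y\<^sub>0' W(y\<^sub>1)\<close> becomes an algebraic differential equation for \<open>Q\<close> that determines its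
  coefficients, the first one up to a sign fixed by \<open>P \<le> 0\<close>.
\<close>

section \<open>Solutions and sign conditions\<close>

lemma is_solution_iff:
  "is_solution T D a y\<^sub>0 \<Phi> \<longleftrightarrow>
     \<Phi> 0 = (0, y\<^sub>0) \<and>
     (\<forall>t. ((\<lambda>t. fst (\<Phi> t)) has_real_derivative T * fst (\<Phi> t) - snd (\<Phi> t)) (at t)) \<and>
     (\<forall>t. ((\<lambda>t. snd (\<Phi> t)) has_real_derivative D * fst (\<Phi> t) - a) (at t))"
proof -
  have "(\<Phi> has_vector_derivative (u, v)) (at t) \<longleftrightarrow>
      ((\<lambda>t. fst (\<Phi> t)) has_real_derivative u) (at t) \<and>
      ((\<lambda>t. snd (\<Phi> t)) has_real_derivative v) (at t)" for u v t
  proof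
    assume *: "(\<Phi> has_vector_derivative (u, v)) (at t)"
    show "((\<lambda>t. fst (\<Phi> t)) has_real_derivative u) (at t) \<and>
      ((\<lambda>t. snd (\<Phi> t)) has_real_derivative v) (at t)"
      using bounded_linear.has_vector_derivative[OF bounded_linear_fst *]
        bounded_linear.has_vector_derivative[OF bounded_linear_snd *]
      by (simp add: has_real_derivative_iff_has_vector_derivative)
  next
    assume "((\<lambda>t. fst (\<Phi> t)) has_real_derivative u) (at t) \<and>
      ((\<lambda>t. snd (\<Phi> t)) has_real_derivative v) (at t)"
    then have "((\<lambda>t. (fst (\<Phi> t), snd (\<Phi> t))) has_vector_derivative (u, v)) (at t)"
      by (intro has_vector_derivative_Pair) (auto simp: has_real_derivative_iff_has_vector_derivative)
    then show "(\<Phi> has_vector_derivative (u, v)) (at t)" by simp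
  qed
  then show ?thesis by (auto simp: is_solution_def)
qed

text \<open>The bound makes \<open>E t * exp (- K * t)\<close> nonincreasing and
  \<open>E t * exp (K * t)\<close> nondecreasing, so a zero of the nonnegative \<open>E\<close>
  propagates forward and backward in time.\<close>

lemma gronwall_zero:
  fixes E E' :: "real \<Rightarrow> real"
  assumes E: "\<And>t. (E has_real_derivative E' t) (at t)"
    and bnd: "\<And>t. \<bar>E' t\<bar> \<le> K * E t"
    and nonneg: "\<And>t. 0 \<le> E t" and zero: "E t\<^sub>0 = 0"
  shows "E t = 0"
proof (cases "t\<^sub>0 \<le> t")
  case True
  have "E t * exp (- K * t) \<le> E t\<^sub>0 * exp (- K * t\<^sub>0)"
  proof (rule DERIV_nonpos_imp_nonincreasing[OF True])
    fix s
    have "((\<lambda>t. E t * exp (- K * t)) has_real_derivative (E' s - K * E s) * exp (- K * s)) (at s)"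
      by (auto intro!: derivative_eq_intros E simp: algebra_simps)
    moreover have "(E' s - K * E s) * exp (- K * s) \<le> 0"
      using bnd[of s] by (intro mult_nonpos_nonneg) auto
    ultimately show "\<exists>y. ((\<lambda>t. E t * exp (- K * t)) has_real_derivative y) (at s) \<and> y \<le> 0" by blast
  qed
  then show ?thesis using nonneg[of t] zero by (simp add: mult_le_0_iff)
next
  case False
  have "E t * exp (K * t) \<le> E t\<^sub>0 * exp (K * t\<^sub>0)"
  proof (rule DERIV_nonneg_imp_nondecreasing[where f = "\<lambda>t. E t * exp (K * t)"])
    fix s
    have "((\<lambda>t. E t * exp (K * t)) has_real_derivative (E' s + K * E s) * exp (K * s)) (at s)"
      by (auto intro!: derivative_eq_intros E simp: algebra_simps)
    moreover have "0 \<le> (E' s + K * E s) * exp (K * s)"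
      using bnd[of s] by (intro mult_nonneg_nonneg) auto
    ultimately show "\<exists>y. ((\<lambda>t. E t * exp (K * t)) has_real_derivative y) (at s) \<and> 0 \<le> y" by blast
  qed (use False in auto)
  then show ?thesis using nonneg[of t] zero by (simp add: mult_le_0_iff)
qed

text \<open>The squared norm obeys the Gronwall bound. The base time \<open>t\<^sub>0\<close> is
  arbitrary because the lemma is applied both at time 0 (uniqueness) and at the final time of an
  orbit (the case \<open>a = 0\<close>).\<close>

lemma homogeneous_system_zero:
  fixes p q :: "real \<Rightarrow> real"
  assumes p: "\<And>t. (p has_real_derivative T * p t - q t) (at t)"
    and q: "\<And>t. (q has_real_derivative D * p t) (at t)"
    and "p t\<^sub>0 = 0" "q t\<^sub>0 = 0"
  shows "p t = 0 \<and> q t = 0"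
proof -
  \<comment> \<open>This is the derivative of \<open>(p t)\<^sup>2 + (q t)\<^sup>2\<close>;
    \<open>K\<close> comes from bounding the mixed term by the sum of squares.\<close>
  define E' where "E' t = 2 * T * (p t)\<^sup>2 + (D - 1) * (2 * (p t * q t))" for t
  define K where "K = 2 * \<bar>T\<bar> + \<bar>D - 1\<bar>"
  have "(p t)\<^sup>2 + (q t)\<^sup>2 = 0"
  proof (rule gronwall_zero[where E = "\<lambda>t. (p t)\<^sup>2 + (q t)\<^sup>2" and t\<^sub>0 = t\<^sub>0 and E' = E' and K = K])
    fix t
    show "((\<lambda>t. (p t)\<^sup>2 + (q t)\<^sup>2) has_real_derivative E' t) (at t)"
      by (auto intro!: derivative_eq_intros p q simp: E'_def power2_eq_square algebra_simps)
    have "2 * \<bar>p t * q t\<bar> \<le> (p t)\<^sup>2 + (q t)\<^sup>2"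
      using sum_squares_bound[of "\<bar>p t\<bar>" "\<bar>q t\<bar>"] by (simp add: abs_mult)
    then have "\<bar>D - 1\<bar> * (2 * \<bar>p t * q t\<bar>) \<le> \<bar>D - 1\<bar> * ((p t)\<^sup>2 + (q t)\<^sup>2)"
      by (intro mult_left_mono) auto
    moreover have "2 * \<bar>T\<bar> * (p t)\<^sup>2 \<le> 2 * \<bar>T\<bar> * ((p t)\<^sup>2 + (q t)\<^sup>2)"
      by (intro mult_left_mono) auto
    moreover have "\<bar>E' t\<bar> \<le> 2 * \<bar>T\<bar> * (p t)\<^sup>2 + \<bar>D - 1\<bar> * (2 * \<bar>p t * q t\<bar>)"
      unfolding E'_def by (rule order_trans[OF abs_triangle_ineq]) (simp add: abs_mult)
    ultimately show "\<bar>E' t\<bar> \<le> K * ((p t)\<^sup>2 + (q t)\<^sup>2)"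
      unfolding K_def distrib_right by linarith
  qed (use assms in auto)
  then show ?thesis by (simp add: sum_power2_eq_zero_iff)
qed

lemma is_solution_unique:
  assumes "is_solution T D a y\<^sub>0 \<Phi>" and "is_solution T D a y\<^sub>0 \<Psi>"
  shows "\<Phi> = \<Psi>"
proof
  fix t
  have "fst (\<Phi> t) - fst (\<Psi> t) = 0 \<and> snd (\<Phi> t) - snd (\<Psi> t) = 0"
    by (rule homogeneous_system_zero[where T = T and D = D and t\<^sub>0 = 0])
      (use assms in \<open>auto simp: is_solution_iff algebra_simps intro!: derivative_eq_intros\<close>)
  then show "\<Phi> t = \<Psi> t" by (simp add: prod_eq_iff)
qed

lemma left_return_unique:
  assumes "left_return T D a y\<^sub>0 y\<^sub>1" and "left_return T D a y\<^sub>0 y\<^sub>1'"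
  shows "y\<^sub>1 = y\<^sub>1'"
proof -
  obtain \<Phi> \<tau> where *: "is_solution T D a y\<^sub>0 \<Phi>" "\<tau> > 0" "fst (\<Phi> \<tau>) = 0"
    "\<forall>t\<in>{0<..<\<tau>}. fst (\<Phi> t) < 0" "snd (\<Phi> \<tau>) = y\<^sub>1"
    using assms(1) unfolding left_return_def by blast
  obtain \<Psi> \<sigma> where **: "is_solution T D a y\<^sub>0 \<Psi>" "\<sigma> > 0" "fst (\<Psi> \<sigma>) = 0"
    "\<forall>t\<in>{0<..<\<sigma>}. fst (\<Psi> t) < 0" "snd (\<Psi> \<sigma>) = y\<^sub>1'"
    using assms(2) unfolding left_return_def by blast
  have "\<Phi> = \<Psi>" using is_solution_unique * ** by blast
  \<comment> \<open>The smaller of two different times would be a zero of the common orbit inside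
    the interval where the other one demands negativity.\<close>
  moreover from this have "\<tau> = \<sigma>"
    using * ** by (metis greaterThanLessThan_iff less_irrefl linorder_neqE_linordered_idom)
  ultimately show ?thesis using * ** by simp
qed

text \<open>The extension clause at 0 applies only if there is no return from 0, so it cannot supply
  a second value.\<close>

lemma left_poincare_map_eq:
  assumes "left_return T D a y\<^sub>0 y\<^sub>1"
  shows "left_poincare_map T D a y\<^sub>0 = y\<^sub>1"
  unfolding left_poincare_map_def
  by (rule the_equality)
    (use assms left_return_unique in \<open>auto simp: left_poincare_graph_def\<close>)

section \<open>Sign conditions forced by an orbit that ends at the origin\<close>

lemma left_return_to_origin_signs:
  assumes ret: "left_return T D a y\<^sub>0 0" and pos: "y\<^sub>0 > 0"
  shows "a < 0" and "T < 0" and "T\<^sup>2 < 4 * D"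
proof -
  obtain \<Phi> \<tau> where sol: "is_solution T D a y\<^sub>0 \<Phi>" and \<tau>: "\<tau> > 0" "fst (\<Phi> \<tau>) = 0"
    "\<forall>t\<in>{0<..<\<tau>}. fst (\<Phi> t) < 0" "snd (\<Phi> \<tau>) = 0"
    using ret unfolding left_return_def by blast
  define x where "x t = fst (\<Phi> t)" for t
  define y where "y t = snd (\<Phi> t)" for t
  have x: "(x has_real_derivative T * x t - y t) (at t)"
    and y: "(y has_real_derivative D * x t - a) (at t)" for t
    using sol by (auto simp: is_solution_iff x_def[abs_def] y_def[abs_def])
  have ini: "x 0 = 0" "y 0 = y\<^sub>0" using sol by (auto simp: is_solution_iff x_def y_def)
  have fin: "x \<tau> = 0" "y \<tau> = 0" and neg: "\<And>t. 0 < t \<Longrightarrow> t < \<tau> \<Longrightarrow> x t < 0"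
    using \<tau> by (auto simp: x_def y_def)
  \<comment> \<open>\<open>w\<close> is the velocity \<open>x'\<close>. It starts at
    \<open>- y\<^sub>0 < 0\<close>, vanishes at \<open>\<tau>\<close>, and has derivative
    \<open>a\<close> there.\<close>
  define w where "w t = T * x t - y t" for t
  have xw: "(x has_real_derivative w t) (at t)" for t
    using x by (simp add: w_def)
  have w: "(w has_real_derivative T * w t - D * x t + a) (at t)" for t
    unfolding w_def by (auto intro!: derivative_eq_intros x y)
  have w_ini: "w 0 = - y\<^sub>0" and w_fin: "w \<tau> = 0" by (simp_all add: w_def ini fin)
  show "a < 0"
  proof (rule ccontr)
    assume "\<not> a < 0"
    then consider "a = 0" | "a > 0" by linarith
    then show False
    proof cases
      case 1
      \<comment> \<open>With \<open>a = 0\<close> the origin is an equilibrium, so an orbit that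
        reaches it must have started there.\<close>
      have "x 0 = 0 \<and> y 0 = 0"
        by (rule homogeneous_system_zero[where T = T and D = D and t\<^sub>0 = \<tau>])
          (use x y fin 1 in auto)
      then show False using ini pos by simp
    next
      case 2
      \<comment> \<open>If \<open>a > 0\<close>, then \<open>w < 0\<close> just before
        \<open>\<tau>\<close>, so \<open>x\<close> decreases to 0 and is positive there.\<close>
      have "(w has_real_derivative a) (at \<tau>)" using w[of \<tau>] by (simp add: fin w_fin)
      from DERIV_pos_inc_left[OF this 2] obtain d where d: "d > 0" "\<And>h. 0 < h \<Longrightarrow> h < d \<Longrightarrow> w (\<tau> - h) < 0"
        using w_fin by auto
      define h where "h = min d \<tau> / 2"
      have h: "0 < h" "h < d" "h < \<tau>" using d(1) \<tau>(1) by (auto simp: h_def)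
      have "x (\<tau> - h) > x \<tau>"
      proof (rule DERIV_neg_imp_decreasing_open[where f = x])
        fix s assume "\<tau> - h < s" "s < \<tau>"
        then show "\<exists>y. (x has_real_derivative y) (at s) \<and> y < 0"
          using xw d(2)[of "\<tau> - s"] h by (auto intro!: exI[of _ "w s"])
      qed (use h x in \<open>auto intro!: DERIV_continuous_on[OF DERIV_subset[OF x]]\<close>)
      then show False using neg[of "\<tau> - h"] fin h by simp
    qed
  qed
  show "T < 0"
  proof (rule ccontr)
    assume "\<not> T < 0"
    \<comment> \<open>The energy has derivative \<open>T * w\<^sup>2\<close>, but falls from
      \<open>y\<^sub>0\<^sup>2 / 2\<close> at time 0 to 0 at \<open>\<tau>\<close>.\<close>
    define N where "N t = (w t)\<^sup>2 / 2 + D * (x t)\<^sup>2 / 2 - a * x t" for t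
    have "N 0 \<le> N \<tau>"
    proof (rule DERIV_nonneg_imp_nondecreasing[where f = N])
      fix s
      have "(N has_real_derivative T * (w s)\<^sup>2) (at s)"
        unfolding N_def by (auto intro!: derivative_eq_intros w xw simp: power2_eq_square field_simps)
      moreover have "0 \<le> T * (w s)\<^sup>2" using \<open>\<not> T < 0\<close> by simp
      ultimately show "\<exists>y. (N has_real_derivative y) (at s) \<and> 0 \<le> y" by blast
    qed (use \<tau> in auto)
    then show False using pos by (simp add: N_def ini fin w_ini w_fin)
  qed
  show "T\<^sup>2 < 4 * D"
  proof (rule ccontr)
    assume "\<not> T\<^sup>2 < 4 * D"
    define r where "r = sqrt (T\<^sup>2 - 4 * D)"
    have r: "r\<^sup>2 = T\<^sup>2 - 4 * D" using \<open>\<not> T\<^sup>2 < 4 * D\<close> by (simp add: r_def)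
    \<comment> \<open>These are the real eigenvalues. Since \<open>w'' = T * w' - D * w\<close>, the
      combination \<open>p = w' - m * w\<close> solves \<open>p' = l * p\<close> and so keeps the
      sign of \<open>p \<tau> = a < 0\<close>. Then \<open>w s * exp (- m * s)\<close> decreases
      strictly, although \<open>w\<close> goes from \<open>- y\<^sub>0 < 0\<close> to 0.\<close>
    define l m where "l = (T + r) / 2" and "m = (T - r) / 2"
    have lm: "l + m = T" "l * m = D"
      using r by (simp_all add: l_def m_def field_simps power2_eq_square)
    define p where "p t = T * w t - D * x t + a - m * w t" for t
    have p: "(p has_real_derivative l * p t) (at t)" for t
      unfolding p_def lm[symmetric]
      using w xw by (auto intro!: derivative_eq_intros simp: lm[symmetric] algebra_simps)
    have "p s * exp (- l * s) = p \<tau> * exp (- l * \<tau>)" for s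
      by (rule DERIV_isconst_all) (auto intro!: derivative_eq_intros p simp: algebra_simps)
    moreover have "p \<tau> * exp (- l * \<tau>) < 0"
      using \<open>a < 0\<close> by (simp add: p_def w_fin fin mult_neg_pos)
    ultimately have p_neg: "p s < 0" for s
      by (metis mult_less_0_iff exp_gt_zero less_asym)
    have "w 0 * exp (- m * 0) > w \<tau> * exp (- m * \<tau>)"
    proof (rule DERIV_neg_imp_decreasing[where f = "\<lambda>s. w s * exp (- m * s)"])
      fix s
      have "((\<lambda>s. w s * exp (- m * s)) has_real_derivative p s * exp (- m * s)) (at s)"
        unfolding p_def by (auto intro!: derivative_eq_intros w simp: algebra_simps)
      moreover have "p s * exp (- m * s) < 0" using p_neg by (simp add: mult_neg_pos)
      ultimately show "\<exists>y. ((\<lambda>s. w s * exp (- m * s)) has_real_derivative y) (at s) \<and> y < 0" by blast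
    qed (use \<tau> in auto)
    then show False using pos by (simp add: w_ini w_fin)
  qed
qed

section \<open>End points of a half-turn as functions of its duration\<close>

text \<open>If an orbit spends the time \<open>t / w\<close> in the half-plane \<open>x < 0\<close>, it starts at \<open>y = c crossing b t\<close>
  and ends at \<open>y = - c crossing (- b) t\<close>, where \<open>T = - 2 b w\<close>, \<open>D = w\<^sup>2 (1 + b\<^sup>2)\<close>,
  \<open>a = - c w (1 + b\<^sup>2)\<close>. The end point is the origin exactly when \<open>spiral b t = 1\<close>.\<close>

definition spiral :: "'a::{real_normed_field,banach} \<Rightarrow> 'a \<Rightarrow> 'a" where
  "spiral b t = exp (b * t) * (cos t - b * sin t)"

definition crossing :: "'a::{real_normed_field,banach} \<Rightarrow> 'a \<Rightarrow> 'a" where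
  "crossing b t = b + (cos t - exp (b * t)) / sin t"

text \<open>One formula serves both the real orbit and its holomorphic extension; this identity and
  the next pass between the two.\<close>

lemma spiral_of_real [simp]: "spiral (of_real b) (of_real t) = of_real (spiral b t)"
  unfolding spiral_def by (simp flip: exp_of_real cos_of_real sin_of_real)

lemma crossing_of_real [simp]: "crossing (of_real b) (of_real t) = of_real (crossing b t)"
  unfolding crossing_def by (simp flip: exp_of_real cos_of_real sin_of_real)

section \<open>Zeros, signs and monotonicity of \<open>spiral\<close> and
  \<open>crossing\<close>\<close>

lemma spiral_deriv:
  "(spiral b has_field_derivative - (1 + b\<^sup>2) * exp (b * t) * sin t) (at t)"
  unfolding spiral_def [abs_def]
  by (auto intro!: derivative_eq_intros simp: power2_eq_square algebra_simps)

lemma crossing_deriv: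
  assumes "sin t \<noteq> 0"
  shows "(crossing b has_field_derivative (spiral b t - 1) / (sin t)\<^sup>2) (at t)"
proof -
  have "(crossing b has_field_derivative
      ((- sin t - exp (b * t) * b) * sin t - (cos t - exp (b * t)) * cos t) / (sin t * sin t)) (at t)"
    unfolding crossing_def [abs_def] using assms
    by (auto intro!: derivative_eq_intros)
  also have "(- sin t - exp (b * t) * b) * sin t - (cos t - exp (b * t)) * cos t
      = spiral b t - ((sin t)\<^sup>2 + (cos t)\<^sup>2)"
    by (simp add: spiral_def power2_eq_square algebra_simps)
  also have "(sin t)\<^sup>2 + (cos t)\<^sup>2 = 1" by simp
  finally show ?thesis by (simp only: power2_eq_square)
qed

text \<open>The zeros of \<open>crossing b\<close> are where \<open>spiral (- b)\<close> is 1, its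
  critical points (by \<open>crossing_deriv\<close>) where \<open>spiral b\<close> is 1. With
  \<open>b\<close> and \<open>- b\<close> exchanged, the end point vanishes exactly where the start
  point is critical: this is the source of the square root in the half-map.\<close>

lemma crossing_eq:
  assumes "sin t \<noteq> 0"
  shows "crossing b t = exp (b * t) * (spiral (- b) t - 1) / sin t"
  using assms by (simp add: crossing_def spiral_def exp_minus field_simps)

text \<open>The derivative of \<open>spiral b\<close> has the sign of \<open>- sin\<close>, so the
  function falls from \<open>spiral b 0 = 1\<close> up to time \<open>pi\<close>. The same sign
  makes it rise on the second half of the period.\<close>

lemma spiral_less_1:
  fixes b t :: real
  assumes "0 < t" "t \<le> pi"
  shows "spiral b t < 1"
proof -
  have "spiral b 0 > spiral b t"
  proof (rule DERIV_neg_imp_decreasing_open[where f = "spiral b"])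
    fix s assume "0 < s" "s < t"
    then have "0 < (1 + b\<^sup>2) * exp (b * s) * sin s"
      using assms by (intro mult_pos_pos sin_gt_zero) (auto simp: add_pos_nonneg)
    then show "\<exists>y. (spiral b has_real_derivative y) (at s) \<and> y < 0"
      by (rule_tac exI, rule_tac conjI[OF spiral_deriv]) (simp only: mult_minus_left neg_less_0_iff_less)
  qed (use assms in \<open>auto intro!: DERIV_continuous_on[OF DERIV_subset[OF spiral_deriv]]\<close>)
  then show ?thesis by (simp add: spiral_def)
qed

lemma spiral_strict_mono:
  fixes b s t :: real
  assumes "pi \<le> s" "s < t" "t \<le> 2 * pi"
  shows "spiral b s < spiral b t"
proof (rule DERIV_pos_imp_increasing_open[where f = "spiral b"])
  fix r assume "s < r" "r < t"
  then have "0 < (1 + b\<^sup>2) * exp (b * r) * (- sin r)"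
    using assms sin_lt_zero[of r] by (intro mult_pos_pos) (auto simp: add_pos_nonneg)
  then show "\<exists>y. (spiral b has_real_derivative y) (at r) \<and> 0 < y"
    by (rule_tac exI, rule_tac conjI[OF spiral_deriv]) (simp only: mult_minus_left mult_minus_right)
qed (use assms in \<open>auto intro!: DERIV_continuous_on[OF DERIV_subset[OF spiral_deriv]]\<close>)

text \<open>On the rising part the values stay below the one at \<open>2 * pi\<close>, which is
  \<open>exp (- 2 * pi * b)\<close>.\<close>

lemma spiral_neg_less_1:
  fixes b t :: real
  assumes "0 < b" "0 < t" "t < 2 * pi"
  shows "spiral (- b) t < 1"
proof (cases "t \<le> pi")
  case True
  then show ?thesis using spiral_less_1 assms by blast
next
  case False
  then have "spiral (- b) t < spiral (- b) (2 * pi)"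
    using assms by (intro spiral_strict_mono) auto
  also have "\<dots> \<le> 1" using assms by (simp add: spiral_def)
  finally show ?thesis .
qed

text \<open>This rules out durations below \<open>pi\<close>: such half-turns would need a negative
  starting value.\<close>

lemma crossing_neg:
  fixes b t :: real
  assumes "0 < b" "0 < t" "t < pi"
  shows "crossing b t < 0"
proof -
  have "0 < sin t" using assms by (simp add: sin_gt_zero)
  then show ?thesis
    using spiral_neg_less_1[of b t] assms
    by (auto simp: crossing_eq intro!: divide_neg_pos mult_pos_neg)
qed

lemma crossing_pos:
  fixes b t :: real
  assumes "0 < b" "pi < t" "t < 2 * pi"
  shows "0 < crossing b t"
proof -
  have "sin t < 0" using assms by (simp add: sin_lt_zero)
  then show ?thesis
    using spiral_neg_less_1[of b t] assms pi_gt_zero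
    by (auto simp: crossing_eq intro!: divide_neg_neg mult_pos_neg)
qed

text \<open>Since \<open>sin t < 0\<close>, \<open>crossing (- b) t\<close> is a positive multiple
  of \<open>1 - spiral b t\<close>. The sign condition on the end point thus becomes a bound on
  \<open>spiral\<close>.\<close>

lemma crossing_minus_nonneg_iff:
  fixes b t :: real
  assumes "pi < t" "t < 2 * pi"
  shows "0 \<le> crossing (- b) t \<longleftrightarrow> spiral b t \<le> 1"
    and "crossing (- b) t = 0 \<longleftrightarrow> spiral b t = 1"
proof -
  have "sin t < 0" using assms by (simp add: sin_lt_zero)
  then show "0 \<le> crossing (- b) t \<longleftrightarrow> spiral b t \<le> 1" "crossing (- b) t = 0 \<longleftrightarrow> spiral b t = 1"
    by (auto simp: crossing_eq zero_le_divide_iff zero_le_mult_iff mult_le_0_iff)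
qed

lemma crossing_minus_strict_antimono:
  fixes b s t :: real
  assumes "0 < b" "pi < s" "s < t" "t < 2 * pi"
  shows "crossing (- b) t < crossing (- b) s"
proof (rule DERIV_neg_imp_decreasing[where f = "crossing (- b)"])
  fix r assume r: "s \<le> r" "r \<le> t"
  then have "sin r < 0" using assms by (simp add: sin_lt_zero)
  then show "\<exists>y. (crossing (- b) has_real_derivative y) (at r) \<and> y < 0"
    using crossing_deriv[of r "- b"] spiral_neg_less_1[of b r] assms r
    by (intro exI[of _ "(spiral (- b) r - 1) / (sin r)\<^sup>2"] conjI divide_neg_pos) auto
qed (use assms in auto)

lemma crossing_strict_antimono:
  fixes b s t :: real
  assumes "pi < s" "s < t" "t < 2 * pi" "spiral b t \<le> 1"
  shows "crossing b t < crossing b s"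
\<comment> \<open>If \<open>spiral b t = 1\<close>, as for the orbit ending at the origin, the
  derivative vanishes at \<open>t\<close> itself; hence its sign is used only inside the
  interval.\<close>
proof (rule DERIV_neg_imp_decreasing_open[where f = "crossing b"])
  fix r assume r: "s < r" "r < t"
  then have "sin r < 0" using assms by (simp add: sin_lt_zero)
  moreover have "spiral b r < 1" using spiral_strict_mono[of r t b] assms r by simp
  ultimately show "\<exists>y. (crossing b has_real_derivative y) (at r) \<and> y < 0"
    using crossing_deriv[of r b]
    by (intro exI[of _ "(spiral b r - 1) / (sin r)\<^sup>2"] conjI divide_neg_pos) auto
next
  have "sin r \<noteq> 0" if "r \<in> {s..t}" for r
    using that assms sin_lt_zero[of r] by auto
  then show "continuous_on {s..t} (crossing b)"
    by (intro DERIV_continuous_on[OF DERIV_subset[OF crossing_deriv]]) auto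
qed (use assms in auto)

text \<open>Up to scaling, \<open>(y - b)\<^sup>2 + 1\<close> is the polynomial \<open>W\<close>, so this is the classical relation
  between \<open>W\<close> at the two end points of a half-turn.\<close>
lemma crossing_quadratic:
  assumes "sin t \<noteq> 0"
  shows "(crossing b t - b)\<^sup>2 + 1 = exp (2 * b * t) * ((- crossing (- b) t - b)\<^sup>2 + 1)"
proof -
  define E s c where "E = exp (b * t)" and "s = sin t" and "c = cos t"
  have E: "E \<noteq> 0" "exp (- (b * t)) = 1 / E" "exp (2 * b * t) = E\<^sup>2"
    by (simp_all add: E_def exp_minus field_simps flip: exp_double)
  have s: "s \<noteq> 0" and cs: "c\<^sup>2 = 1 - s\<^sup>2"
    using assms by (simp_all add: s_def c_def cos_squared_eq)
  have "((c - E) / s)\<^sup>2 + 1 = E\<^sup>2 * (((1 / E - c) / s)\<^sup>2 + 1)"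
  proof -
    \<comment> \<open>Both sides expand to \<open>E\<^sup>2 - 2 * c * E + 1\<close>.\<close>
    have "(c - E)\<^sup>2 + s\<^sup>2 = E\<^sup>2 * ((c - 1 / E)\<^sup>2 + s\<^sup>2)"
      using E(1) by (simp add: field_simps power2_diff cs)
    then have "((c - E)\<^sup>2 + s\<^sup>2) / s\<^sup>2 = E\<^sup>2 * (((c - 1 / E)\<^sup>2 + s\<^sup>2) / s\<^sup>2)" by simp
    then show ?thesis using s by (simp add: add_divide_distrib power_divide power2_commute[of "1 / E"])
  qed
  then show ?thesis
    by (simp add: crossing_def E s_def[symmetric] c_def[symmetric] E_def[symmetric]
        power_divide power2_commute[of "1 / E" c])
qed

text \<open>By \<open>crossing_eq\<close>, \<open>y\<^sub>0' * y\<^sub>0\<close> is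
  \<open>exp (2 * b * t)\<close> times \<open>y\<^sub>1' * y\<^sub>1\<close>. The two quadratics
  differ by the same factor, so the explicit time dependence cancels.\<close>

lemma crossing_ode:
  fixes b t :: "'a::{real_normed_field,banach}"
  assumes "sin t \<noteq> 0"
  defines "y\<^sub>0 \<equiv> crossing b t" and "y\<^sub>1 \<equiv> - crossing (- b) t"
    and "y\<^sub>0' \<equiv> (spiral b t - 1) / (sin t)\<^sup>2" and "y\<^sub>1' \<equiv> - ((spiral (- b) t - 1) / (sin t)\<^sup>2)"
  shows "y\<^sub>1' * y\<^sub>1 * ((y\<^sub>0 - b)\<^sup>2 + 1) = y\<^sub>0' * y\<^sub>0 * ((y\<^sub>1 - b)\<^sup>2 + 1)"
proof -
  define E s G H where "E = exp (b * t)" and "s = sin t"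
    and "G = spiral b t - 1" and "H = spiral (- b) t - 1"
  have E: "E \<noteq> 0" "exp (- (b * t)) = inverse E" "exp (2 * b * t) = E * E"
    using exp_double[of "b * t"] by (simp_all add: E_def exp_minus mult.assoc power2_eq_square)
  have y0: "y\<^sub>0 = E * H / s" and y1: "y\<^sub>1 = - (inverse E * G / s)"
    using assms(1) E(2) by (simp_all add: y\<^sub>0_def y\<^sub>1_def crossing_eq E_def s_def G_def H_def)
  have y0': "y\<^sub>0' = G / s\<^sup>2" and y1': "y\<^sub>1' = - (H / s\<^sup>2)"
    by (simp_all add: y\<^sub>0'_def y\<^sub>1'_def s_def G_def H_def)
  have "y\<^sub>0' * y\<^sub>0 = exp (2 * b * t) * (y\<^sub>1' * y\<^sub>1)"
    unfolding y0 y1 y0' y1' E(3) using E(1) by (simp add: power2_eq_square)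
  then have "y\<^sub>0' * y\<^sub>0 * ((y\<^sub>1 - b)\<^sup>2 + 1) = y\<^sub>1' * y\<^sub>1 * (exp (2 * b * t) * ((y\<^sub>1 - b)\<^sup>2 + 1))"
    by (simp only: mult_ac)
  also have "exp (2 * b * t) * ((y\<^sub>1 - b)\<^sup>2 + 1) = (y\<^sub>0 - b)\<^sup>2 + 1"
    unfolding y\<^sub>0_def y\<^sub>1_def by (rule crossing_quadratic[OF assms(1), symmetric])
  finally show ?thesis by (rule sym)
qed

text \<open>Damped oscillation about the equilibrium \<open>x = - c / w\<close> with
  \<open>x = 0\<close>, \<open>x' = - y\<^sub>0\<close> at time 0; the second component is recovered
  from the first equation as \<open>T * x - x'\<close>.\<close>

definition focus_flow :: "real \<Rightarrow> real \<Rightarrow> real \<Rightarrow> real \<Rightarrow> real \<Rightarrow> real \<times> real" where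
  "focus_flow b w c y\<^sub>0 t =
    (let x = (exp (- (b * (w * t))) * (c * cos (w * t) + (b * c - y\<^sub>0) * sin (w * t)) - c) / w;
         x' = - exp (- (b * (w * t))) * (y\<^sub>0 * cos (w * t) + (c * (1 + b\<^sup>2) - b * y\<^sub>0) * sin (w * t))
     in (x, - 2 * b * w * x - x'))"

section \<open>Half-turns of a focus in terms of their duration\<close>

context
  fixes b w c :: real
  assumes b: "0 < b" and w: "0 < w" and c: "0 < c"
begin

lemma is_solution_focus_flow:
  "is_solution (- 2 * b * w) (w\<^sup>2 * (1 + b\<^sup>2)) (- c * w * (1 + b\<^sup>2)) y\<^sub>0 (focus_flow b w c y\<^sub>0)"
  unfolding is_solution_iff focus_flow_def Let_def fst_conv snd_conv
  using w by (auto intro!: derivative_eq_intros simp: field_simps power2_eq_square)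

text \<open>Dividing by the sine isolates the starting value: the orbit meets the section exactly
  when \<open>y\<^sub>0 = c * crossing b (w * t)\<close>, and otherwise the sign of \<open>x\<close>
  can be read off.\<close>

lemma fst_focus_flow:
  assumes "sin (w * t) \<noteq> 0"
  shows "fst (focus_flow b w c y\<^sub>0 t) =
    exp (- (b * (w * t))) * sin (w * t) * (c * crossing b (w * t) - y\<^sub>0) / w"
  using assms w by (simp add: focus_flow_def Let_def crossing_def exp_minus field_simps)

text \<open>Reversing time and reflecting \<open>y\<close> exchanges \<open>b\<close> with
  \<open>- b\<close> and turns the end of a half-turn into its start, which explains the form of the
  result.\<close>

lemma snd_focus_flow:
  assumes "sin (w * t) \<noteq> 0" and "y\<^sub>0 = c * crossing b (w * t)"
  shows "snd (focus_flow b w c y\<^sub>0 t) = - c * crossing (- b) (w * t)"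
proof -
  define E s k where "E = exp (b * (w * t))" and "s = sin (w * t)" and "k = cos (w * t)"
  have E: "E \<noteq> 0" "exp (- (b * (w * t))) = 1 / E"
    by (simp_all add: E_def exp_minus field_simps)
  have s: "s \<noteq> 0" and ks: "k * k = 1 - s * s"
    using assms cos_squared_eq[of "w * t"] by (simp_all add: s_def k_def power2_eq_square)
  have y0: "y\<^sub>0 = c * (b + (k - E) / s)"
    using assms(2) by (simp add: crossing_def E_def s_def k_def)
  have "snd (focus_flow b w c y\<^sub>0 t) = - 2 * b * w * fst (focus_flow b w c y\<^sub>0 t)
      + 1 / E * (y\<^sub>0 * k + (c * (1 + b\<^sup>2) - b * y\<^sub>0) * s)"
    by (simp add: focus_flow_def Let_def E(2) s_def[symmetric] k_def[symmetric])
  also have "fst (focus_flow b w c y\<^sub>0 t) = 0" using assms by (simp add: fst_focus_flow)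
  also have "- 2 * b * w * 0 + 1 / E * (y\<^sub>0 * k + (c * (1 + b\<^sup>2) - b * y\<^sub>0) * s)
      = 1 / E * (y\<^sub>0 * k + (c * (1 + b\<^sup>2) - b * y\<^sub>0) * s)" by simp
  also have "y\<^sub>0 * k + (c * (1 + b\<^sup>2) - b * y\<^sub>0) * s = c * (k * k + s * s - k * E + b * E * s) / s"
    using s by (simp add: y0 field_simps power2_eq_square)
  also have "1 / E * \<dots> = - c * (- b + (k - 1 / E) / s)"
    using s E by (simp add: ks field_simps)
  finally show ?thesis by (simp add: crossing_def E s_def k_def)
qed

text \<open>The parameter is \<open>\<theta> = w * \<tau>\<close>. A first return takes between half
  a period and a full one, and \<open>spiral b \<theta> \<le> 1\<close> expresses that it does not
  end above the origin. Conversely, the factored form of \<open>x\<close> and the monotonicity of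
  \<open>crossing b\<close> give the sign of \<open>x\<close> before
  \<open>\<theta>\<close>.\<close>

lemma left_return_focus_iff:
  "left_return (- 2 * b * w) (w\<^sup>2 * (1 + b\<^sup>2)) (- c * w * (1 + b\<^sup>2)) y\<^sub>0 y\<^sub>1 \<longleftrightarrow>
    (\<exists>\<theta>. pi < \<theta> \<and> \<theta> < 2 * pi \<and> spiral b \<theta> \<le> 1 \<and>
      y\<^sub>0 = c * crossing b \<theta> \<and> y\<^sub>1 = - c * crossing (- b) \<theta>)"
    (is "?L \<longleftrightarrow> ?R")
proof
  assume ?L
  then obtain \<Phi> \<tau> where y0: "y\<^sub>0 \<ge> 0" and
      sol: "is_solution (- 2 * b * w) (w\<^sup>2 * (1 + b\<^sup>2)) (- c * w * (1 + b\<^sup>2)) y\<^sub>0 \<Phi>" and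
      \<tau>: "\<tau> > 0" "fst (\<Phi> \<tau>) = 0" "\<forall>t\<in>{0<..<\<tau>}. fst (\<Phi> t) < 0" "snd (\<Phi> \<tau>) = y\<^sub>1"
    unfolding left_return_def by blast
  have \<Phi>: "\<Phi> = focus_flow b w c y\<^sub>0"
    using is_solution_unique[OF sol is_solution_focus_flow] .
  define x where "x t = fst (\<Phi> t)" for t
  have x_neg: "x t < 0" if "0 < t" "t < \<tau>" for t using \<tau> that by (simp add: x_def)
  have x_fin: "x \<tau> = 0" using \<tau> by (simp add: x_def)
  have x_0: "x 0 = 0" using sol by (simp add: is_solution_iff x_def)
  define \<theta> where "\<theta> = w * \<tau>"
  have \<theta>_pos: "0 < \<theta>" using w \<tau> by (simp add: \<theta>_def)
  have x_eq: "x t = (exp (- (b * (w * t))) * (c * cos (w * t) + (b * c - y\<^sub>0) * sin (w * t)) - c) / w" for t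
    by (simp add: x_def \<Phi> focus_flow_def)
  have trig: "c * cos \<theta> + (b * c - y\<^sub>0) * sin \<theta> = c * exp (b * \<theta>)"
  proof -
    have "exp (- (b * \<theta>)) * (c * cos \<theta> + (b * c - y\<^sub>0) * sin \<theta>) = c"
      using x_fin w unfolding x_eq \<theta>_def[symmetric] by simp
    then show ?thesis by (simp add: exp_minus field_simps)
  qed
  have "\<theta> < 2 * pi"
  proof (rule ccontr)
    assume "\<not> \<theta> < 2 * pi"
    \<comment> \<open>One full turn before \<open>\<tau>\<close> the trigonometric factors agree but
      the damping factor is larger, so \<open>x\<close> is positive at a time where it should be at
      most 0.\<close>
    define t where "t = \<tau> - 2 * pi / w"
    have wt: "w * t = \<theta> - 2 * pi" using w by (simp add: t_def \<theta>_def field_simps)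
    have "0 \<le> t" using \<open>\<not> \<theta> < 2 * pi\<close> w by (simp add: t_def \<theta>_def field_simps)
    have "cos (w * t) = cos \<theta>" "sin (w * t) = sin \<theta>"
      unfolding wt by (simp_all add: cos_diff sin_diff)
    then have "x t = (exp (- (b * (w * t))) * (c * exp (b * \<theta>)) - c) / w"
      by (simp only: x_eq trig)
    also have "\<dots> = c * (exp (2 * pi * b) - 1) / w"
      unfolding wt by (simp add: right_diff_distrib algebra_simps flip: exp_add)
    finally have "x t > 0" using b w c by simp
    moreover have "x t \<le> 0"
      using x_neg[of t] x_0 \<open>0 \<le> t\<close> w by (cases "t = 0") (auto simp: t_def)
    ultimately show False by simp
  qed
  \<comment> \<open>At \<open>pi\<close> the equation \<open>trig\<close> would read
    \<open>- c = c * exp (b * pi)\<close>.\<close>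
  have "\<theta> \<noteq> pi"
  proof
    assume "\<theta> = pi"
    then show False using trig c by (simp add: mult_less_0_iff) (smt (verit) exp_gt_zero mult_pos_pos)
  qed
  then have sin: "sin \<theta> \<noteq> 0"
    using \<theta>_pos \<open>\<theta> < 2 * pi\<close> sin_gt_zero[of \<theta>] sin_lt_zero[of \<theta>] by linarith
  have y0_eq: "y\<^sub>0 = c * crossing b \<theta>"
    using trig sin by (simp add: crossing_def field_simps)
  have "pi < \<theta>"
    using crossing_neg[of b \<theta>] b c y0 y0_eq \<theta>_pos \<open>\<theta> \<noteq> pi\<close> by (smt (verit) mult_pos_neg)
  have y1_eq: "y\<^sub>1 = - c * crossing (- b) \<theta>"
    using snd_focus_flow[of \<tau> y\<^sub>0] sin y0_eq \<tau> by (simp add: \<Phi> \<theta>_def)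
  have "y\<^sub>1 \<le> 0"
  proof (rule ccontr)
    assume "\<not> y\<^sub>1 \<le> 0"
    \<comment> \<open>If \<open>y\<^sub>1 > 0\<close>, then \<open>x\<close> decreases through 0 at
      \<open>\<tau>\<close> and is positive just before.\<close>
    have "(x has_real_derivative - y\<^sub>1) (at \<tau>)"
      using sol \<tau> unfolding x_def[abs_def] is_solution_iff by (metis diff_0 mult_zero_right)
    with \<open>\<not> y\<^sub>1 \<le> 0\<close> obtain d where d: "d > 0" "\<And>h. 0 < h \<Longrightarrow> h < d \<Longrightarrow> x \<tau> < x (\<tau> - h)"
      using DERIV_neg_dec_left[of x "- y\<^sub>1" \<tau>] by auto
    define h where "h = min d \<tau> / 2"
    have "0 < h" "h < d" "h < \<tau>" using d(1) \<tau>(1) by (auto simp: h_def)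
    then show False using d(2)[of h] x_neg[of "\<tau> - h"] x_fin by simp
  qed
  then have "spiral b \<theta> \<le> 1"
    using crossing_minus_nonneg_iff(1)[of \<theta> b] \<open>pi < \<theta>\<close> \<open>\<theta> < 2 * pi\<close> c y1_eq
    by (simp add: zero_le_mult_iff)
  with \<open>pi < \<theta>\<close> \<open>\<theta> < 2 * pi\<close> y0_eq y1_eq show ?R by blast
next
  assume ?R
  then obtain \<theta> where \<theta>: "pi < \<theta>" "\<theta> < 2 * pi" "spiral b \<theta> \<le> 1"
    and y0: "y\<^sub>0 = c * crossing b \<theta>" and y1: "y\<^sub>1 = - c * crossing (- b) \<theta>" by blast
  have y0_pos: "0 < y\<^sub>0" using crossing_pos[OF b \<theta>(1,2)] c y0 by simp
  define \<tau> where "\<tau> = \<theta> / w"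
  have \<tau>: "w * \<tau> = \<theta>" "0 < \<tau>" using w \<theta> pi_gt_zero by (auto simp: \<tau>_def)
  have sin: "sin \<theta> \<noteq> 0" using sin_lt_zero[of \<theta>] \<theta> by simp
  have "fst (focus_flow b w c y\<^sub>0 t) < 0" if t: "0 < t" "t < \<tau>" for t
  proof -
    have wt: "0 < w * t" "w * t < \<theta>" using t w \<tau> by (auto simp flip: \<tau>(1))
    \<comment> \<open>The factored form of \<open>x\<close> covers the outer cases. At
      \<open>w * t = pi\<close> the sine vanishes and \<open>x\<close> is evaluated
      directly.\<close>
    consider "w * t < pi" | "w * t = pi" | "pi < w * t" by linarith
    then show ?thesis
    proof cases
      case 1
      then have "0 < sin (w * t)" using wt by (simp add: sin_gt_zero)
      moreover have "c * crossing b (w * t) - y\<^sub>0 < 0"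
        using crossing_neg[OF b wt(1) 1] c y0_pos by (smt (verit) mult_pos_neg)
      ultimately show ?thesis
        using w by (auto simp: fst_focus_flow intro!: divide_neg_pos mult_pos_neg)
    next
      case 2
      have "- (exp (- (b * pi)) * c) < c" using mult_pos_pos[OF exp_gt_zero c, of "- (b * pi)"] c by linarith
      then show ?thesis using c w by (simp add: focus_flow_def Let_def 2 divide_less_0_iff)
    next
      case 3
      then have "sin (w * t) < 0" using wt \<theta> by (simp add: sin_lt_zero)
      moreover have "0 < c * crossing b (w * t) - y\<^sub>0"
        using crossing_strict_antimono[OF 3 wt(2) \<theta>(2,3)] c y0 by simp
      ultimately show ?thesis
        using w by (simp add: fst_focus_flow divide_less_0_iff mult_less_0_iff)
    qed
  qed
  moreover have "fst (focus_flow b w c y\<^sub>0 \<tau>) = 0"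
    using sin by (simp add: fst_focus_flow \<tau> y0)
  moreover have "snd (focus_flow b w c y\<^sub>0 \<tau>) = y\<^sub>1"
    using snd_focus_flow[of \<tau> y\<^sub>0] sin by (simp add: \<tau> y0 y1)
  ultimately show ?L
    unfolding left_return_def using y0_pos \<tau> is_solution_focus_flow by force
qed

end

section \<open>Analytic inversion at regular and quadratic points\<close>

lemma holomorphic_power_series_Re:
  assumes hol: "F holomorphic_on ball (of_real u) r" and x: "\<bar>x - u\<bar> < r"
  shows "(\<lambda>n. Re ((deriv ^^ n) F (of_real u) / fact n) * (x - u) ^ n) sums Re (F (of_real x))"
proof -
  have "of_real x \<in> ball (of_real u :: complex) r"
    using x by (simp add: dist_norm abs_minus_commute flip: of_real_diff)
  from holomorphic_power_series[OF hol this]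
  have "(\<lambda>n. Re ((deriv ^^ n) F (of_real u) / fact n * of_real ((x - u) ^ n))) sums Re (F (of_real x))"
    by (simp add: sums_complex_iff)
  then show ?thesis by (simp only: Re_complex_of_real times_complex.sel Im_complex_of_real mult_zero_right diff_zero)
qed

lemma real_analytic_at_Re:
  assumes "F holomorphic_on A" "open A" "of_real u \<in> A"
  shows "real_analytic_at (\<lambda>x. Re (F (of_real x))) u"
proof -
  obtain r where r: "r > 0" "ball (of_real u) r \<subseteq> A" using assms openE by blast
  then have "F holomorphic_on ball (of_real u) r" using assms(1) holomorphic_on_subset by blast
  then show ?thesis
    unfolding real_analytic_at_def
    by (intro exI[of _ "\<lambda>n. Re ((deriv ^^ n) F (of_real u) / fact n)"] exI[of _ r] conjI r(1))
      (auto intro: holomorphic_power_series_Re)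
qed

text \<open>The derivative rule is kept as a product equal to 1, so that it also records that
  \<open>deriv f\<close> has no zero on the ball.\<close>

lemma holomorphic_local_inverse:
  assumes "f holomorphic_on S" "open S" "\<xi> \<in> S" "deriv f \<xi> \<noteq> 0"
  obtains r g where "r > 0" "ball \<xi> r \<subseteq> S" "open (f ` ball \<xi> r)" "g holomorphic_on f ` ball \<xi> r"
    "\<And>z. z \<in> ball \<xi> r \<Longrightarrow> g (f z) = z"
    "\<And>z. z \<in> ball \<xi> r \<Longrightarrow> deriv f z * deriv g (f z) = 1"
proof -
  obtain r where r: "r > 0" "ball \<xi> r \<subseteq> S" "open (f ` ball \<xi> r)" "inj_on f (ball \<xi> r)"
    using has_complex_derivative_locally_invertible assms by metis
  have "f holomorphic_on ball \<xi> r" using assms(1) r(2) holomorphic_on_subset by blast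
  then show ?thesis
    using holomorphic_has_inverse[OF _ open_ball r(4)] that r(1,2,3) by metis
qed

lemma real_continuous_of_holomorphic:
  fixes x :: "real \<Rightarrow> real"
  assumes "X holomorphic_on S" and "\<And>t. t \<in> A \<Longrightarrow> of_real t \<in> S \<and> X (of_real t) = of_real (x t)"
  shows "continuous_on A x"
proof -
  have "continuous_on (of_real ` A) X"
    by (rule continuous_on_subset[OF holomorphic_on_imp_continuous_on[OF assms(1)]])
      (use assms(2) in auto)
  then have "continuous_on A (\<lambda>t. Re (X (of_real t)))"
    by (intro continuous_on_Re) (rule continuous_on_compose2, auto intro: continuous_on_of_real)
  then show ?thesis
    by (rule continuous_on_eq) (simp add: assms(2))
qed

text \<open>With \<open>G\<close> a local inverse of \<open>X\<close> at \<open>\<theta>\<close>,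
  the curve is the graph of the real part of \<open>Y \<circ> G\<close>. Strict monotonicity of
  \<open>x\<close> on the whole interval ensures that values near \<open>x \<theta>\<close> come
  only from parameters near \<open>\<theta>\<close>, where \<open>G\<close> inverts
  \<open>X\<close>.\<close>

lemma real_analytic_inverse_parametrization:
  fixes x y :: "real \<Rightarrow> real" and X Y :: "complex \<Rightarrow> complex"
  assumes X: "X holomorphic_on S" and Y: "Y holomorphic_on S" and S: "open S"
    and real: "\<And>t. l < t \<Longrightarrow> t < u \<Longrightarrow>
      of_real t \<in> S \<and> X (of_real t) = of_real (x t) \<and> Y (of_real t) = of_real (y t)"
    and mono: "\<And>s t. l < s \<Longrightarrow> s < t \<Longrightarrow> t < u \<Longrightarrow> x s < x t"
    and \<theta>: "l < \<theta>" "\<theta> < u" and "deriv X (of_real \<theta>) \<noteq> 0"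
  shows "\<exists>U g. open U \<and> x \<theta> \<in> U \<and> (\<forall>v\<in>U. real_analytic_at g v) \<and>
    (\<forall>t. l < t \<longrightarrow> t < u \<longrightarrow> x t \<in> U \<longrightarrow> g (x t) = y t)"
proof -
  obtain r G where r: "r > 0" "ball (of_real \<theta>) r \<subseteq> S" "open (X ` ball (of_real \<theta>) r)"
      "G holomorphic_on X ` ball (of_real \<theta>) r"
    and G: "\<And>z. z \<in> ball (of_real \<theta>) r \<Longrightarrow> G (X z) = z"
    using holomorphic_local_inverse[OF X S _ assms(8)] real \<theta> by metis
  define A where "A = X ` ball (of_real \<theta>) r"
  define \<delta> where "\<delta> = min r (min (\<theta> - l) (u - \<theta>)) / 2"
  have \<delta>: "0 < \<delta>" "\<delta> < r" "l < \<theta> - \<delta>" "\<theta> + \<delta> < u"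
    using r(1) \<theta> by (auto simp: \<delta>_def min_def field_simps)
  define g where "g v = Re ((Y \<circ> G) (of_real v))" for v
  \<comment> \<open>By the intermediate value theorem every point of \<open>U\<close> is some
    \<open>x t\<close> with \<open>t\<close> within \<open>\<delta>\<close> of
    \<open>\<theta>\<close>, hence lies in the domain of \<open>G\<close>.\<close>
  define U where "U = {x (\<theta> - \<delta>)<..<x (\<theta> + \<delta>)}"
  have ball: "of_real t \<in> ball (of_real \<theta> :: complex) r" if "\<bar>t - \<theta>\<bar> \<le> \<delta>" for t
    using that \<delta> by (simp add: dist_norm abs_minus_commute flip: of_real_diff)
  have YG: "Y \<circ> G holomorphic_on A"
    unfolding A_def
    by (rule holomorphic_on_compose_gen[OF r(4) Y]) (use G r(2) in auto)
  have cont: "continuous_on {\<theta> - \<delta>..\<theta> + \<delta>} x"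
    by (rule real_continuous_of_holomorphic[OF X]) (use real \<delta> in auto)
  have "real_analytic_at g v" if v: "v \<in> U" for v
  proof -
    obtain t where t: "\<theta> - \<delta> \<le> t" "t \<le> \<theta> + \<delta>" "x t = v"
      using IVT'[of x "\<theta> - \<delta>" v "\<theta> + \<delta>"] v cont \<delta>(1) by (auto simp: U_def)
    then have "of_real v = X (of_real t)" using real[of t] \<delta> by simp
    then have "of_real v \<in> A" using ball[of t] t by (auto simp: A_def)
    then show ?thesis
      unfolding g_def[abs_def] using real_analytic_at_Re[OF YG] r(3) by (simp add: A_def)
  qed
  moreover have "g (x t) = y t" if t: "l < t" "t < u" "x t \<in> U" for t
  proof -
    have "\<not> t < \<theta> - \<delta>" "\<not> \<theta> + \<delta> < t"
      using mono[of t "\<theta> - \<delta>"] mono[of "\<theta> + \<delta>" t] t \<delta> by (auto simp: U_def)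
    then have "G (X (of_real t)) = of_real t" by (intro G ball) auto
    then show ?thesis using real[of t] t by (simp add: g_def)
  qed
  moreover have "x \<theta> \<in> U"
    using mono[of "\<theta> - \<delta>" \<theta>] mono[of \<theta> "\<theta> + \<delta>"] \<delta> \<theta> by (simp add: U_def)
  moreover have "open U" by (simp add: U_def)
  ultimately show ?thesis by blast
qed

text \<open>At the double zero \<open>\<xi>\<close> one has \<open>X - X \<xi> = R\<^sup>2\<close>,
  where \<open>R\<close> has a simple zero and a local inverse \<open>H\<close>. Put
  \<open>Q z = Y (H (- z))\<close>: the minus sign selects the branch of real parameters
  \<open>t \<le> \<theta>\<close>, on which \<open>R\<close> is nonpositive. The real clause
  identifies values of \<open>Q\<close>, the complex one yields its differential equation.\<close>

lemma holomorphic_square_root_parametrization: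
  fixes x :: "real \<Rightarrow> real" and X Y :: "complex \<Rightarrow> complex"
  assumes X: "X holomorphic_on S" and Y: "Y holomorphic_on S" and S: "open S"
    and real: "\<And>t. l < t \<Longrightarrow> t \<le> \<theta> \<Longrightarrow> of_real t \<in> S \<and> X (of_real t) = of_real (x t)"
    and \<theta>: "l < \<theta>" and min: "\<And>t. l < t \<Longrightarrow> t < \<theta> \<Longrightarrow> x \<theta> < x t"
    and d1: "deriv X (of_real \<theta>) = 0" and d2: "deriv (deriv X) (of_real \<theta>) \<noteq> 0"
  obtains Q r where "r > 0" "Q holomorphic_on ball 0 r"
    "\<And>z. 0 \<le> z \<Longrightarrow> z < r \<Longrightarrow>
      \<exists>t. l < t \<and> t \<le> \<theta> \<and> x t = x \<theta> + z\<^sup>2 \<and> Q (of_real z) = Y (of_real t)"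
    "\<And>z. z \<in> ball 0 r \<Longrightarrow>
      \<exists>w\<in>S. X w = of_real (x \<theta>) + z\<^sup>2 \<and> Q z = Y w \<and> deriv Q z * deriv X w = 2 * z * deriv Y w \<and>
        (z \<noteq> 0 \<longrightarrow> deriv X w \<noteq> 0)"
proof -
  define \<xi> where "\<xi> = complex_of_real \<theta>"
  have \<xi>: "\<xi> \<in> S" "X \<xi> = of_real (x \<theta>)" using real \<theta> by (auto simp: \<xi>_def)
  obtain g r0 where r0: "0 < r0" and g: "g holomorphic_on ball \<xi> r0"
    and Xg: "\<And>w. w \<in> ball \<xi> r0 \<Longrightarrow> X w - X \<xi> = (w - \<xi>)\<^sup>2 * g w"
    and g0: "\<And>w. w \<in> ball \<xi> r0 \<Longrightarrow> g w \<noteq> 0"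
  proof (rule holomorphic_factor_order_of_zero[OF X S \<xi>(1), of 2])
    show "(deriv ^^ i) X \<xi> = 0" if "0 < i" "i < 2" for i
    proof -
      have "i = 1" using that by linarith
      then show ?thesis using d1 by (simp add: \<xi>_def)
    qed
  qed (use d2 in \<open>auto simp: \<xi>_def numeral_2_eq_2\<close>)
  have near: "of_real t \<in> ball \<xi> e" if "\<bar>t - \<theta>\<bar> < e" for t e
    using that by (simp add: \<xi>_def dist_norm abs_minus_commute flip: of_real_diff)
  have g_real: "g (of_real t) = of_real ((x t - x \<theta>) / (t - \<theta>)\<^sup>2)"
    if "l < t" "\<theta> - r0 < t" "t < \<theta>" for t
  proof -
    have "of_real (x t - x \<theta>) = of_real ((t - \<theta>)\<^sup>2) * g (of_real t)"
      using Xg[OF near[of t r0]] that real[of t] \<xi>(2) by (simp add: \<xi>_def)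
    then show ?thesis using that by (simp add: field_simps)
  qed
  have gc: "continuous_on (ball \<xi> r0) g" using g by (rule holomorphic_on_imp_continuous_on)
  \<comment> \<open>Approached from the left, \<open>g \<xi>\<close> is a limit of positive real
    quotients; being nonzero, it is real and positive.\<close>
  have lim: "((\<lambda>t. g (of_real t)) \<longlongrightarrow> g \<xi>) (at_left \<theta>)"
  proof (rule isCont_tendsto_compose[where g = g])
    show "isCont g \<xi>" using gc r0 by (simp add: continuous_on_eq_continuous_at)
    show "(of_real \<longlongrightarrow> \<xi>) (at_left \<theta>)" unfolding \<xi>_def by (intro tendsto_intros)
  qed
  have ev: "eventually (\<lambda>t. t \<in> {max l (\<theta> - r0)<..<\<theta>}) (at_left \<theta>)"
    using \<theta> r0 by (intro eventually_at_left_field[THEN iffD2]) (auto intro!: exI[of _ "max l (\<theta> - r0)"])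
  have "Im (g \<xi>) = 0"
  proof (rule tendsto_unique[OF _ tendsto_Im[OF lim]])
    show "((\<lambda>t. Im (g (of_real t))) \<longlongrightarrow> 0) (at_left \<theta>)"
      by (rule tendsto_eventually, rule eventually_mono[OF ev]) (simp add: g_real)
  qed simp
  moreover have "Re (g \<xi>) \<ge> 0"
  proof (rule tendsto_lowerbound[OF tendsto_Re[OF lim]])
    show "eventually (\<lambda>t. 0 \<le> Re (g (of_real t))) (at_left \<theta>)"
      by (rule eventually_mono[OF ev]) (use min in \<open>auto simp: g_real less_imp_le\<close>)
  qed simp
  moreover have "g \<xi> \<noteq> 0" using g0 r0 by simp
  ultimately have Re_g: "0 < Re (g \<xi>)" by (simp add: complex_eq_iff)
  \<comment> \<open>A positive real part keeps \<open>g\<close> off the branch cut of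
    \<open>csqrt\<close>.\<close>
  obtain r1 where r1: "0 < r1" "r1 \<le> r0" "\<And>w. w \<in> ball \<xi> r1 \<Longrightarrow> 0 < Re (g w)"
  proof -
    have "open (ball \<xi> r0 \<inter> (\<lambda>w. Re (g w)) -` {0<..})"
      by (intro continuous_open_preimage continuous_intros gc) auto
    then obtain e where "e > 0" "ball \<xi> e \<subseteq> ball \<xi> r0 \<inter> (\<lambda>w. Re (g w)) -` {0<..}"
      using Re_g r0 by (elim openE[of _ \<xi>]) auto
    then show ?thesis using that[of "min e r0"] r0 by (auto simp: subset_iff)
  qed
  define R where "R w = (w - \<xi>) * csqrt (g w)" for w
  have g1: "g holomorphic_on ball \<xi> r1" using g r1(2) by (auto intro: holomorphic_on_subset)
  have hol_csqrt: "(\<lambda>w. csqrt (g w)) holomorphic_on ball \<xi> r1"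
    by (intro holomorphic_on_csqrt' g1) (use r1(3) in \<open>auto simp: complex_nonpos_Reals_iff\<close>, fastforce)
  have R: "R holomorphic_on ball \<xi> r1"
    unfolding R_def by (intro holomorphic_intros hol_csqrt)
  have R_sq: "X w = X \<xi> + (R w)\<^sup>2" if "w \<in> ball \<xi> r1" for w
    using Xg[of w] that r1(2) by (simp add: R_def power_mult_distrib diff_eq_eq add.commute)
  have "deriv R \<xi> = csqrt (g \<xi>)"
  proof (rule DERIV_imp_deriv)
    have "((\<lambda>w. csqrt (g w)) has_field_derivative deriv (\<lambda>w. csqrt (g w)) \<xi>) (at \<xi>)"
      using holomorphic_derivI[OF hol_csqrt open_ball] r1(1) by simp
    from DERIV_mult[OF DERIV_diff[OF DERIV_ident DERIV_const[of \<xi>]] this]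
    show "(R has_field_derivative csqrt (g \<xi>)) (at \<xi>)"
      by (simp add: R_def[abs_def])
  qed
  then have "deriv R \<xi> \<noteq> 0" using \<open>g \<xi> \<noteq> 0\<close> by simp
  obtain r2 H where r2: "r2 > 0" "ball \<xi> r2 \<subseteq> ball \<xi> r1 \<inter> S" "open (R ` ball \<xi> r2)"
      and H: "H holomorphic_on R ` ball \<xi> r2"
    and HR: "\<And>w. w \<in> ball \<xi> r2 \<Longrightarrow> H (R w) = w"
    and dHR: "\<And>w. w \<in> ball \<xi> r2 \<Longrightarrow> deriv R w * deriv H (R w) = 1"
    by (rule holomorphic_local_inverse[of R "ball \<xi> r1 \<inter> S" \<xi>])
      (use R S \<xi> r1 \<open>deriv R \<xi> \<noteq> 0\<close> in \<open>auto intro: holomorphic_on_subset\<close>)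
  have "0 \<in> R ` ball \<xi> r2" using r2(1) by (intro image_eqI[of _ _ \<xi>]) (auto simp: R_def)
  then obtain \<rho> where \<rho>: "\<rho> > 0" "ball 0 \<rho> \<subseteq> R ` ball \<xi> r2" using r2(3) openE by blast
  define \<delta> where "\<delta> = min r2 (\<theta> - l) / 2"
  have \<delta>: "0 < \<delta>" "\<delta> < r2" "l < \<theta> - \<delta>" using r2(1) \<theta> by (auto simp: \<delta>_def min_def field_simps)
  \<comment> \<open>The second bound keeps \<open>x \<theta> + z\<^sup>2\<close> below
    \<open>x (\<theta> - \<delta>)\<close>, so that the intermediate value theorem finds a parameter
    in \<open>[\<theta> - \<delta>, \<theta>]\<close>.\<close>
  define r where "r = min \<rho> (sqrt (x (\<theta> - \<delta>) - x \<theta>))"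
  define Q where "Q z = Y (H (- z))" for z
  have r: "0 < r" "r \<le> \<rho>" using \<rho>(1) min[of "\<theta> - \<delta>"] \<delta> by (auto simp: r_def)
  have Hneg: "(\<lambda>z. H (- z)) holomorphic_on ball 0 r"
  proof -
    have "H \<circ> uminus holomorphic_on ball 0 r"
      by (rule holomorphic_on_compose_gen[OF _ H]) (use \<rho> r in \<open>auto intro!: holomorphic_intros\<close>)
    then show ?thesis by (simp add: o_def)
  qed
  have preimage: "\<exists>w\<in>ball \<xi> r2. R w = - z \<and> H (- z) = w" if "z \<in> ball 0 r" for z
  proof -
    have "- z \<in> R ` ball \<xi> r2" using that \<rho>(2) r(2) by auto
    then show ?thesis using HR by fastforce
  qed
  show ?thesis
  proof (rule that[of r Q])
    show "0 < r" by (rule r)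
    show Q: "Q holomorphic_on ball 0 r"
    proof -
      have "Y \<circ> (\<lambda>z. H (- z)) holomorphic_on ball 0 r"
        by (rule holomorphic_on_compose_gen[OF Hneg Y]) (use preimage r2(2) in fastforce)
      then show ?thesis by (simp add: o_def Q_def[abs_def])
    qed
    show "\<exists>t. l < t \<and> t \<le> \<theta> \<and> x t = x \<theta> + z\<^sup>2 \<and> Q (of_real z) = Y (of_real t)"
      if z: "0 \<le> z" "z < r" for z
    proof -
      have "z\<^sup>2 < (sqrt (x (\<theta> - \<delta>) - x \<theta>))\<^sup>2"
        using z by (intro power_strict_mono) (auto simp: r_def)
      then have z2: "x \<theta> + z\<^sup>2 \<le> x (\<theta> - \<delta>)" using min[of "\<theta> - \<delta>"] \<delta> by simp
      have "continuous_on {\<theta> - \<delta>..\<theta>} x"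
        by (rule real_continuous_of_holomorphic[OF X]) (use real \<delta> in auto)
      then obtain t where t: "\<theta> - \<delta> \<le> t" "t \<le> \<theta>" "x t = x \<theta> + z\<^sup>2"
        using IVT2'[of x \<theta> "x \<theta> + z\<^sup>2" "\<theta> - \<delta>"] z2 \<delta>(1) by auto
      have t_ball: "of_real t \<in> ball \<xi> r2" using t \<delta> by (intro near) auto
      then have "of_real t \<in> ball \<xi> r0" using r2(2) subset_ball[OF r1(2)] by blast
      then have t_r0: "\<theta> - r0 < t" by (simp add: \<xi>_def dist_norm flip: of_real_diff)
      have "R (of_real t) = - of_real z"
      proof (cases "t = \<theta>")
        case True
        then show ?thesis using t(3) by (simp add: R_def \<xi>_def)
      next
        case False
        then have "t < \<theta>" using t by simp
        have "g (of_real t) = of_real ((z / (\<theta> - t))\<^sup>2)"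
          using g_real[of t] t \<open>t < \<theta>\<close> \<delta> t_r0 by (simp add: power_divide power2_commute)
        then have "csqrt (g (of_real t)) = of_real (z / (\<theta> - t))"
          using z \<open>t < \<theta>\<close> by (simp add: csqrt_of_real real_sqrt_divide del: of_real_divide)
        then have "R (of_real t) = of_real ((t - \<theta>) * (z / (\<theta> - t)))"
          by (simp add: R_def \<xi>_def)
        also have "(t - \<theta>) * (z / (\<theta> - t)) = - z" using \<open>t < \<theta>\<close> by (simp add: field_simps)
        finally show ?thesis by simp
      qed
      then have "H (- of_real z) = of_real t" using HR[OF t_ball] by simp
      then show ?thesis using t \<delta> by (intro exI[of _ t]) (auto simp: Q_def)
    qed
    show "\<exists>w\<in>S. X w = of_real (x \<theta>) + z\<^sup>2 \<and> Q z = Y w \<and> deriv Q z * deriv X w = 2 * z * deriv Y w \<and>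
        (z \<noteq> 0 \<longrightarrow> deriv X w \<noteq> 0)" if z: "z \<in> ball 0 r" for z
    proof -
      obtain w where w: "w \<in> ball \<xi> r2" "R w = - z" "H (- z) = w" using preimage[OF z] by blast
      have wS: "w \<in> S" "w \<in> ball \<xi> r1" using w(1) r2(2) by auto
      have dR: "(R has_field_derivative deriv R w) (at w)"
        using holomorphic_derivI[OF R open_ball wS(2)] by simp
      \<comment> \<open>Differentiating \<open>R\<^sup>2\<close> where \<open>R w = - z\<close>
        produces the factor \<open>- 2 * z\<close>, which together with the inverse rule for
        \<open>H\<close> gives the relation for \<open>deriv Q\<close>.\<close>
      have "((\<lambda>w. X \<xi> + (R w)\<^sup>2) has_field_derivative - 2 * z * deriv R w) (at w)"
        using dR w(2) by (auto intro!: derivative_eq_intros)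
      then have "(X has_field_derivative - 2 * z * deriv R w) (at w)"
        by (rule has_field_derivative_transform_within_open[OF _ open_ball wS(2)]) (simp add: R_sq)
      then have dX: "deriv X w = - 2 * z * deriv R w" by (rule DERIV_imp_deriv)
      have "- z \<in> R ` ball \<xi> r2" using w by (metis imageI)
      then have dH: "(H has_field_derivative deriv H (- z)) (at (- z))"
        using holomorphic_derivI[OF H r2(3)] by blast
      have dY: "(Y has_field_derivative deriv Y w) (at (H (- z)))"
        using holomorphic_derivI[OF Y S wS(1)] w(3) by simp
      have "((\<lambda>z. H (- z)) has_field_derivative deriv H (- z) * (- 1)) (at z)"
        by (rule DERIV_chain2[where f = H and g = uminus, OF dH]) (auto intro!: derivative_eq_intros)
      from DERIV_chain2[where f = Y and g = "\<lambda>z. H (- z)", OF dY this]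
      have dQ: "deriv Q z = - deriv Y w * deriv H (- z)"
        unfolding Q_def[abs_def] by (intro DERIV_imp_deriv) simp
      have RH: "deriv R w * deriv H (- z) = 1" using dHR[OF w(1)] w(2) by simp
      have "deriv Q z * deriv X w = 2 * z * deriv Y w * (deriv R w * deriv H (- z))"
        unfolding dQ dX by (simp add: mult_ac)
      moreover have "z \<noteq> 0 \<longrightarrow> deriv X w \<noteq> 0" using RH by (auto simp: dX)
      moreover have "X w = of_real (x \<theta>) + z\<^sup>2" using R_sq[OF wS(2)] w(2) \<xi>(2) by simp
      ultimately show ?thesis using wS(1) RH w(3) by (auto simp: Q_def)
    qed
  qed
qed

section \<open>Coefficients of the expansion\<close>

text \<open>Since \<open>sqrt (y - p) ^ 4 = (y - p)\<^sup>2\<close>, the remainder divided by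
  \<open>(y - p)\<^sup>2\<close> is again a power series in \<open>sqrt (y - p)\<close>; it has a
  limit at \<open>p\<close>, hence is bounded.\<close>

lemma newton_puiseux_remainder_bigo:
  assumes "has_newton_puiseux_half f S p c"
  shows "(\<lambda>y. f y - (\<Sum>n<4. c n * sqrt (y - p) ^ n)) \<in> O[at_right p](\<lambda>y. (y - p)\<^sup>2)"
proof -
  obtain r where r: "r > 0" and sums: "\<And>y. y \<in> {p..<p + r} \<Longrightarrow> (\<lambda>n. c n * sqrt (y - p) ^ n) sums f y"
    using assms unfolding has_newton_puiseux_half_def by blast
  define G where "G z = (\<Sum>n. c (n + 4) * z ^ n)" for z
  have tail: "(\<lambda>n. c (n + 4) * sqrt (y - p) ^ n) sums
      ((f y - (\<Sum>n<4. c n * sqrt (y - p) ^ n)) / (y - p)\<^sup>2)" if "p < y" "y < p + r" for y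
  proof -
    have z: "sqrt (y - p) ^ 4 = (y - p)\<^sup>2" "y - p \<noteq> 0"
      using that power_mult[of "sqrt (y - p)" 2 2] by simp_all
    have "(\<lambda>n. c (n + 4) * sqrt (y - p) ^ (n + 4)) sums (f y - (\<Sum>n<4. c n * sqrt (y - p) ^ n))"
      using sums[of y] that by (intro sums_split_initial_segment) auto
    then have "(\<lambda>n. c (n + 4) * sqrt (y - p) ^ (n + 4) / (y - p)\<^sup>2) sums
        ((f y - (\<Sum>n<4. c n * sqrt (y - p) ^ n)) / (y - p)\<^sup>2)"
      by (rule sums_divide)
    then show ?thesis using z by (simp add: power_add)
  qed
  have "isCont G 0"
    unfolding G_def
    \<comment> \<open>Convergence of the tail at \<open>y = p + r / 2\<close> supplies a positive
      radius.\<close>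
    by (rule isCont_powser[where K = "sqrt (r / 2)"])
      (use tail[of "p + r / 2"] r in \<open>auto intro: sums_summable\<close>)
  moreover have "((\<lambda>y. sqrt (y - p)) \<longlongrightarrow> sqrt (p - p)) (at_right p)" by (intro tendsto_intros)
  ultimately have "((\<lambda>y. G (sqrt (y - p))) \<longlongrightarrow> G (sqrt (p - p))) (at_right p)"
    by (intro isCont_tendsto_compose[where g = G]) auto
  moreover have "eventually (\<lambda>y. G (sqrt (y - p)) =
      (f y - (\<Sum>n<4. c n * sqrt (y - p) ^ n)) / (y - p)\<^sup>2) (at_right p)"
    unfolding eventually_at_right_field
    using r by (intro exI[of _ "p + r"]) (auto simp: G_def intro!: sums_unique[symmetric] tail)
  ultimately show ?thesis
    by (intro bigoI_tendsto) (auto simp: tendsto_cong eventually_at_filter)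
qed

text \<open>Coefficient comparison in \<open>Q Q' W(h + z\<^sup>2) = 2 z (h + z\<^sup>2) W(Q)\<close>, where
  \<open>w0 = W(h)\<close>, \<open>w1 = W'(h)\<close> and \<open>k = a T\<close>.\<close>
lemma fps_puiseux_coeffs:
  fixes A :: "'a::field_char_0 fps"
  assumes "A * fps_deriv A * (fps_const w0 + fps_const w1 * fps_X ^ 2 + fps_const D * fps_X ^ 4)
      = 2 * fps_X * (fps_const h + fps_X ^ 2) * (fps_const D * A ^ 2 - fps_const k * A + fps_const (a ^ 2))"
    and A0: "A $ 0 = 0"
  shows "w0 * (A $ 1) ^ 2 = 2 * h * a ^ 2"
    and "3 * w0 * (A $ 1 * A $ 2) = - (2 * h * k * A $ 1)"
    and "w0 * (4 * (A $ 1 * A $ 3) + 2 * (A $ 2) ^ 2) + w1 * (A $ 1) ^ 2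
      = 2 * a ^ 2 + 2 * h * (D * (A $ 1) ^ 2 - k * A $ 2)"
proof -
  define G where "G = A * fps_deriv A"
  define B where "B = fps_const D * A ^ 2 - fps_const k * A + fps_const (a ^ 2)"
  have G: "G $ Suc 0 = (A $ 1) ^ 2" "G $ 2 = 3 * (A $ 1 * A $ 2)"
      "G $ 3 = 4 * (A $ 1 * A $ 3) + 2 * (A $ 2) ^ 2"
    using A0 by (simp_all add: G_def fps_mult_nth numeral_2_eq_2 numeral_3_eq_3 power2_eq_square algebra_simps)
  have B: "B $ 0 = a ^ 2" "B $ Suc 0 = - (k * A $ 1)" "B $ 2 = D * (A $ 1) ^ 2 - k * A $ 2"
    using A0 by (simp_all add: B_def power2_eq_square fps_mult_nth numeral_2_eq_2)
  have L: "(A * fps_deriv A * (fps_const w0 + fps_const w1 * fps_X ^ 2 + fps_const D * fps_X ^ 4)) $ n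
      = w0 * G $ n + w1 * (if n < 2 then 0 else G $ (n - 2)) + D * (if n < 4 then 0 else G $ (n - 4))" for n
  proof -
    have "A * fps_deriv A * (fps_const w0 + fps_const w1 * fps_X ^ 2 + fps_const D * fps_X ^ 4)
      = fps_const w0 * G + fps_const w1 * (fps_X ^ 2 * G) + fps_const D * (fps_X ^ 4 * G)"
      by (simp add: G_def algebra_simps)
    then show ?thesis by (simp add: fps_X_power_mult_nth)
  qed
  have R: "(2 * fps_X * (fps_const h + fps_X ^ 2) * B) $ n
      = 2 * h * (if n < 1 then 0 else B $ (n - 1)) + 2 * (if n < 3 then 0 else B $ (n - 3))" for n
  proof -
    have two: "(2 :: 'a fps) = fps_const 2" by (simp add: numeral_fps_const)
    have "2 * fps_X * (fps_const h + fps_X ^ 2) * B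
      = fps_const 2 * fps_const h * (fps_X ^ 1 * B) + fps_const 2 * (fps_X ^ 3 * B)"
      unfolding two by (simp add: algebra_simps power3_eq_cube power2_eq_square del: fps_const_mult)
    also have "fps_const 2 * fps_const h = fps_const (2 * h)" by simp
    finally show ?thesis by (simp only: fps_add_nth fps_mult_left_const_nth fps_X_power_mult_nth)
  qed
  have eq: "w0 * G $ n + w1 * (if n < 2 then 0 else G $ (n - 2)) + D * (if n < 4 then 0 else G $ (n - 4))
    = 2 * h * (if n < 1 then 0 else B $ (n - 1)) + 2 * (if n < 3 then 0 else B $ (n - 3))" for n
    using arg_cong[OF assms(1), of "\<lambda>F. F $ n"] unfolding L B_def[symmetric] R .
  have "G $ 0 = 0" using A0 by (simp add: G_def)
  \<comment> \<open>The coefficients of degrees 1, 2 and 3 determine \<open>A $ 1\<close> up to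
    sign, then \<open>A $ 2\<close>, then \<open>A $ 3\<close>.\<close>
  show "w0 * (A $ 1) ^ 2 = 2 * h * a ^ 2" using eq[of 1] by (simp add: G B)
  show "3 * w0 * (A $ 1 * A $ 2) = - (2 * h * k * A $ 1)"
    using eq[of 2] \<open>G $ 0 = 0\<close> by (simp add: G B numeral_2_eq_2[symmetric] mult_ac)
  show "w0 * (4 * (A $ 1 * A $ 3) + 2 * (A $ 2) ^ 2) + w1 * (A $ 1) ^ 2
      = 2 * a ^ 2 + 2 * h * (D * (A $ 1) ^ 2 - k * A $ 2)"
    using eq[of 3] by (simp add: G B)
qed

text \<open>The relation is linear in \<open>c\<^sub>3\<close> with factor
  \<open>4 * w\<^sub>0 * (a * s)\<close>; both candidates are compared after multiplication by this
  nonzero number.\<close>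

lemma third_coefficient:
  fixes s K w\<^sub>0 a h T D c\<^sub>1 c\<^sub>2 c\<^sub>3 :: real
  assumes "s\<^sup>2 = K" "K > 0" "a \<noteq> 0" "h > 0" "w\<^sub>0 * K = 2 * h" "w\<^sub>0 = D * h\<^sup>2 - a * T * h + a\<^sup>2"
    and c1: "c\<^sub>1 = a * s" and c2: "c\<^sub>2 = - (a * T / 3) * K"
    and c3: "w\<^sub>0 * (4 * (c\<^sub>1 * c\<^sub>3) + 2 * c\<^sub>2\<^sup>2) + (2 * D * h - a * T) * c\<^sub>1\<^sup>2
      = 2 * a\<^sup>2 + 2 * h * (D * c\<^sub>1\<^sup>2 - a * T * c\<^sub>2)"
  shows "c\<^sub>3 = a ^ 3 / 72 * ((9 * D + 2 * T\<^sup>2) / a\<^sup>2 + 9 / h\<^sup>2) * s ^ 3"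
proof -
  have "s \<noteq> 0" "w\<^sub>0 \<noteq> 0" using assms by auto
  have c1_sq: "c\<^sub>1\<^sup>2 = a\<^sup>2 * K" using assms(1) by (simp add: c1 power_mult_distrib)
  \<comment> \<open>Substituting \<open>2 * h = w\<^sub>0 * K\<close> and expanding
    \<open>w\<^sub>0 / h\<close> gives every term the common factor
    \<open>a\<^sup>2 * K\<close>.\<close>
  have two: "2 * a\<^sup>2 = a\<^sup>2 * K * (D * h - a * T + a\<^sup>2 / h)"
  proof -
    have "2 * h * a\<^sup>2 = a\<^sup>2 * K * (D * h - a * T + a\<^sup>2 / h) * h"
      unfolding assms(5)[symmetric] assms(6) using assms(4) by (simp add: field_simps power2_eq_square)
    then show ?thesis using assms(4) by simp
  qed
  have w_c2: "w\<^sub>0 * (2 * c\<^sub>2\<^sup>2) = a\<^sup>2 * K * (4 * h * T\<^sup>2 / 9)"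
  proof -
    have "w\<^sub>0 * (2 * c\<^sub>2\<^sup>2) = 2 * (a * T / 3)\<^sup>2 * K * (w\<^sub>0 * K)"
      by (simp add: c2 power2_eq_square)
    then show ?thesis by (simp add: assms(5) power2_eq_square)
  qed
  have "4 * w\<^sub>0 * (a * s) * c\<^sub>3 = w\<^sub>0 * (4 * (c\<^sub>1 * c\<^sub>3) + 2 * c\<^sub>2\<^sup>2) - w\<^sub>0 * (2 * c\<^sub>2\<^sup>2)"
    by (simp add: c1 algebra_simps)
  also have "\<dots> = 2 * a\<^sup>2 + 2 * h * (D * c\<^sub>1\<^sup>2 - a * T * c\<^sub>2) - (2 * D * h - a * T) * c\<^sub>1\<^sup>2
      - a\<^sup>2 * K * (4 * h * T\<^sup>2 / 9)"
    unfolding w_c2 using c3 by linarith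
  also have "\<dots> = a\<^sup>2 * K * (D * h + a\<^sup>2 / h + 2 * h * T\<^sup>2 / 9)"
    unfolding two c1_sq c2 by (simp add: field_simps power2_eq_square)
  also have "\<dots> = 4 * w\<^sub>0 * (a * s) * (a ^ 3 / 72 * ((9 * D + 2 * T\<^sup>2) / a\<^sup>2 + 9 / h\<^sup>2) * s ^ 3)"
  proof -
    have "4 * w\<^sub>0 * (a * s) * (a ^ 3 / 72 * ((9 * D + 2 * T\<^sup>2) / a\<^sup>2 + 9 / h\<^sup>2) * s ^ 3)
      = (w\<^sub>0 * s\<^sup>2) * s\<^sup>2 * a ^ 4 / 18 * ((9 * D + 2 * T\<^sup>2) / a\<^sup>2 + 9 / h\<^sup>2)"
      by (simp add: power2_eq_square power3_eq_cube power4_eq_xxxx)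
    also have "\<dots> = a\<^sup>2 * K * (D * h + a\<^sup>2 / h + 2 * h * T\<^sup>2 / 9)"
      unfolding assms(1,5) using assms(3,4) by (simp add: field_simps power2_eq_square power4_eq_xxxx)
    finally show ?thesis by simp
  qed
  finally show ?thesis using \<open>s \<noteq> 0\<close> \<open>w\<^sub>0 \<noteq> 0\<close> assms(3) by (simp only: mult_cancel_left) simp
qed

section \<open>The half-map of a focus\<close>

lemma holomorphic_crossing: "crossing b holomorphic_on {z. sin z \<noteq> 0}"
proof -
  have "open {z::complex. sin z \<noteq> 0}"
    by (intro open_Collect_neq continuous_intros)
  then show ?thesis
    by (auto simp: holomorphic_on_open intro: crossing_deriv)
qed

context
  fixes b w c \<theta> T D a yhat :: real
  assumes b: "0 < b" and w: "0 < w" and c: "0 < c"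
    and T: "T = - 2 * b * w" and D: "D = w\<^sup>2 * (1 + b\<^sup>2)" and a: "a = - c * w * (1 + b\<^sup>2)"
    and \<theta>: "pi < \<theta>" "\<theta> < 2 * pi" "spiral b \<theta> = 1" and yhat: "yhat = c * crossing b \<theta>"
begin

section \<open>Domain, monotonicity and injectivity\<close>

lemma spiral_le_1_iff: "pi < t \<Longrightarrow> t < 2 * pi \<Longrightarrow> spiral b t \<le> 1 \<longleftrightarrow> t \<le> \<theta>"
  using spiral_strict_mono[of t \<theta> b] spiral_strict_mono[of \<theta> t b] \<theta> by (cases t \<theta> rule: linorder_cases) auto

text \<open>\<open>\<theta>\<close> is the duration of the half-turn ending at the origin. Longer
  ones would end above it, so the admissible durations fill \<open>{pi<..\<theta>}\<close>.\<close>

lemma return_iff: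
  "left_return T D a u v \<longleftrightarrow> (\<exists>t\<in>{pi<..\<theta>}. u = c * crossing b t \<and> v = - c * crossing (- b) t)"
proof -
  have "pi < t \<and> t < 2 * pi \<and> spiral b t \<le> 1 \<longleftrightarrow> t \<in> {pi<..\<theta>}" for t
    using spiral_le_1_iff[of t] \<theta> by auto
  then show ?thesis unfolding T D a left_return_focus_iff[OF b w c] by blast
qed

lemma start_decreasing: "pi < s \<Longrightarrow> s < t \<Longrightarrow> t \<le> \<theta> \<Longrightarrow> c * crossing b t < c * crossing b s"
  using crossing_strict_antimono[of s t b] spiral_le_1_iff[of t] \<theta> c by simp

lemma start_ge_yhat: "pi < t \<Longrightarrow> t \<le> \<theta> \<Longrightarrow> yhat \<le> c * crossing b t"
  using start_decreasing[of t \<theta>] yhat by (cases "t = \<theta>") auto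

lemma end_increasing:
  "pi < s \<Longrightarrow> s < t \<Longrightarrow> t < 2 * pi \<Longrightarrow> - c * crossing (- b) s < - c * crossing (- b) t"
  using crossing_minus_strict_antimono[OF b, of s t] c by simp

lemma end_zero: "crossing (- b) \<theta> = 0"
  using crossing_minus_nonneg_iff(2)[of \<theta> b] \<theta> by simp

lemma yhat_pos: "0 < yhat"
  using crossing_pos[OF b \<theta>(1,2)] c yhat by simp

text \<open>Every return starts at \<open>yhat > 0\<close> or above, so the extension clause at 0
  already fails for \<open>\<epsilon> = yhat\<close>.\<close>

lemma graph_iff: "left_poincare_graph T D a u v \<longleftrightarrow> left_return T D a u v"
proof -
  have "\<not> (\<forall>\<epsilon>>0. \<exists>u\<in>{0<..<\<epsilon>}. \<exists>v\<in>{-\<epsilon><..<0}. left_return T D a u v)"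
    using yhat_pos start_ge_yhat by (force simp: return_iff not_less intro!: exI[of _ yhat])
  then show ?thesis unfolding left_poincare_graph_def by blast
qed

lemma domain_eq: "left_poincare_dom T D a = (\<lambda>t. c * crossing b t) ` {pi<..\<theta>}"
  by (auto simp: left_poincare_dom_def graph_iff return_iff)

lemma map_eq:
  assumes "pi < t" "t \<le> \<theta>"
  shows "left_poincare_map T D a (c * crossing b t) = - c * crossing (- b) t"
  by (rule left_poincare_map_eq) (use assms in \<open>auto simp: return_iff\<close>)

lemma sin_nonzero: "pi < t \<Longrightarrow> t < 2 * pi \<Longrightarrow> sin t \<noteq> 0"
  using sin_lt_zero[of t] by simp

lemma is_interval_domain: "is_interval (left_poincare_dom T D a)"
proof -
  have "continuous_on {pi<..\<theta>} (\<lambda>t. c * crossing b t)"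
    by (intro continuous_intros DERIV_continuous_on[OF DERIV_subset[OF crossing_deriv]])
      (use sin_nonzero \<theta> in auto)
  then have "connected ((\<lambda>t. c * crossing b t) ` {pi<..\<theta>})"
    by (rule connected_continuous_image) simp
  then show ?thesis unfolding domain_eq is_interval_connected_1 .
qed

lemma inj_on_map: "inj_on (left_poincare_map T D a) (left_poincare_dom T D a)"
proof (rule inj_onI)
  fix u v
  assume "u \<in> left_poincare_dom T D a" "v \<in> left_poincare_dom T D a"
    and eq: "left_poincare_map T D a u = left_poincare_map T D a v"
  then obtain s t where st: "pi < s" "s \<le> \<theta>" "u = c * crossing b s" "pi < t" "t \<le> \<theta>" "v = c * crossing b t"
    by (auto simp: domain_eq)
  then have "- c * crossing (- b) s = - c * crossing (- b) t" using eq map_eq by simp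
  then have "s = t"
    using end_increasing[of s t] end_increasing[of t s] st \<theta> by (cases s t rule: linorder_cases) auto
  then show "u = v" using st by simp
qed

section \<open>Complexified end points and the analytic inverse\<close>

definition start_c where "start_c z = complex_of_real c * crossing (complex_of_real b) z"
definition end_c where "end_c z = - complex_of_real c * crossing (- complex_of_real b) z"

lemma holomorphic_start_end:
  "start_c holomorphic_on {z. sin z \<noteq> 0}" "end_c holomorphic_on {z. sin z \<noteq> 0}"
  unfolding start_c_def[abs_def] end_c_def[abs_def]
  by (intro holomorphic_intros holomorphic_crossing)+

lemma open_sin_nonzero: "open {z::complex. sin z \<noteq> 0}"
  by (intro open_Collect_neq continuous_intros)

lemma start_end_of_real:
  "start_c (of_real t) = of_real (c * crossing b t)" "end_c (of_real t) = of_real (- c * crossing (- b) t)"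
  using crossing_of_real[of "- b" t, where 'a = complex]
  by (simp_all add: start_c_def end_c_def)

lemma deriv_start:
  "sin z \<noteq> 0 \<Longrightarrow> deriv start_c z = of_real c * ((spiral (of_real b) z - 1) / (sin z)\<^sup>2)"
  unfolding start_c_def[abs_def] by (intro DERIV_imp_deriv DERIV_cmult crossing_deriv)

lemma deriv_end:
  "sin z \<noteq> 0 \<Longrightarrow> deriv end_c z = of_real c * - ((spiral (- of_real b) z - 1) / (sin z)\<^sup>2)"
  unfolding end_c_def[abs_def]
  by (rule DERIV_imp_deriv) (auto intro!: derivative_eq_intros crossing_deriv)

lemma sin_of_real_nonzero: "pi < t \<Longrightarrow> t < 2 * pi \<Longrightarrow> sin (complex_of_real t) \<noteq> 0"
  using sin_nonzero[of t] by (metis of_real_eq_0_iff sin_of_real)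

text \<open>The end point has nonzero derivative on all of \<open>(pi, 2 pi)\<close>, since
  \<open>spiral (- b) < 1\<close> there. The parametrization continues past \<open>\<theta>\<close>,
  which gives analyticity in a full neighbourhood of the end point 0 as well.\<close>

lemma real_analytic_inverse:
  "real_analytic_on (the_inv_into (left_poincare_dom T D a) (left_poincare_map T D a))
     (left_poincare_map T D a ` left_poincare_dom T D a)"
  unfolding real_analytic_on_def
proof
  fix v assume "v \<in> left_poincare_map T D a ` left_poincare_dom T D a"
  then obtain t where t: "pi < t" "t \<le> \<theta>" "v = - c * crossing (- b) t"
    using map_eq by (auto simp: domain_eq)
  have "spiral (- b) t - 1 < 0" using spiral_neg_less_1[OF b, of t] t \<theta> pi_gt_zero by auto
  then have "deriv end_c (of_real t) \<noteq> 0"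
    using sin_of_real_nonzero[of t] spiral_of_real[of "- b" t, where 'a = complex] t \<theta> c
    by (simp add: deriv_end)
  then obtain U g where U: "open U" "- c * crossing (- b) t \<in> U" "\<forall>v\<in>U. real_analytic_at g v"
    and g: "\<And>s. pi < s \<Longrightarrow> s < 2 * pi \<Longrightarrow> - c * crossing (- b) s \<in> U \<Longrightarrow>
      g (- c * crossing (- b) s) = c * crossing b s"
    using real_analytic_inverse_parametrization[OF holomorphic_start_end(2,1) open_sin_nonzero,
        of pi "2 * pi" "\<lambda>t. - c * crossing (- b) t" "\<lambda>t. c * crossing b t" t]
      end_increasing sin_of_real_nonzero start_end_of_real t \<theta> by auto
  have "the_inv_into (left_poincare_dom T D a) (left_poincare_map T D a) u = g u"
    if u: "u \<in> left_poincare_map T D a ` left_poincare_dom T D a" "u \<in> U" for u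
  proof -
    obtain s where s: "pi < s" "s \<le> \<theta>" "u = - c * crossing (- b) s"
      using u(1) map_eq by (auto simp: domain_eq)
    have "the_inv_into (left_poincare_dom T D a) (left_poincare_map T D a) u = c * crossing b s"
      by (rule the_inv_into_f_eq[OF inj_on_map]) (use s map_eq in \<open>auto simp: domain_eq\<close>)
    also have "\<dots> = g u" using g[of s] s \<theta> u(2) by simp
    finally show ?thesis .
  qed
  then show "\<exists>U g. open U \<and> v \<in> U \<and> (\<forall>u\<in>U. real_analytic_at g u) \<and>
      (\<forall>u\<in>left_poincare_map T D a ` left_poincare_dom T D a \<inter> U.
        the_inv_into (left_poincare_dom T D a) (left_poincare_map T D a) u = g u)"
    using U t by (intro exI[of _ U] exI[of _ g]) auto
qed

section \<open>Square root parametrization and the expansion at \<open>yhat\<close>\<close>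

lemma W_eq: "W T D a y = D * ((y - c * b)\<^sup>2 + c\<^sup>2)"
  \<comment> \<open>Completing the square, with \<open>a * T = 2 * b * c * D\<close> and
    \<open>a\<^sup>2 = D * c\<^sup>2 * (1 + b\<^sup>2)\<close>.\<close>
  by (simp add: W_def T D a power2_eq_square algebra_simps)

lemma invariant_c:
  assumes "sin z \<noteq> 0"
  defines "x \<equiv> start_c z" and "y \<equiv> end_c z"
  shows "deriv end_c z * y * (of_real D * x\<^sup>2 - of_real (a * T) * x + of_real (a\<^sup>2))
    = deriv start_c z * x * (of_real D * y\<^sup>2 - of_real (a * T) * y + of_real (a\<^sup>2))"
proof -
  have W: "of_real D * (of_real c * u)\<^sup>2 - of_real (a * T) * (of_real c * u) + of_real (a\<^sup>2)
    = of_real (D * c\<^sup>2) * ((u - of_real b)\<^sup>2 + 1)" for u :: complex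
    by (simp add: T D a power2_eq_square algebra_simps)
  have y: "y = of_real c * (- crossing (- of_real b) z)" by (simp add: y_def end_c_def)
  show ?thesis
    unfolding deriv_start[OF assms(1)] deriv_end[OF assms(1)] x_def start_c_def y W
    using crossing_ode[OF assms(1), of "of_real b"] by (simp only: mult_ac)
qed

lemma W_pos: "0 < W T D a y"
proof -
  have "0 < D" using w by (simp add: D add_pos_nonneg)
  then show ?thesis using c by (simp add: W_eq add_nonneg_pos)
qed

lemma a_neg: "a < 0"
  using w c by (simp add: a mult_neg_pos add_pos_nonneg)

text \<open>The derivative of the start point has a simple zero at \<open>\<theta>\<close>, so the
  square root construction applies with \<open>Y\<close> the end point; \<open>invariant_c\<close>
  turns into the differential equation of \<open>Q\<close>.\<close>

lemma square_root_parametrization: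
  obtains Q r where "r > 0" "Q holomorphic_on ball 0 r"
    "\<And>z. 0 \<le> z \<Longrightarrow> z < r \<Longrightarrow> \<exists>t. pi < t \<and> t \<le> \<theta> \<and> c * crossing b t = yhat + z\<^sup>2 \<and>
      Q (of_real z) = of_real (- c * crossing (- b) t)"
    "\<And>z. z \<in> ball 0 r \<Longrightarrow>
      Q z * deriv Q z * (of_real D * (of_real yhat + z\<^sup>2)\<^sup>2 - of_real (a * T) * (of_real yhat + z\<^sup>2) + of_real (a\<^sup>2))
      = 2 * z * (of_real yhat + z\<^sup>2) * (of_real D * (Q z)\<^sup>2 - of_real (a * T) * Q z + of_real (a\<^sup>2))"
proof -
  let ?S = "{z::complex. sin z \<noteq> 0}"
  have \<theta>S: "of_real \<theta> \<in> ?S" using sin_of_real_nonzero \<theta> by simp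
  have d1: "deriv start_c (of_real \<theta>) = 0"
    using \<theta> \<theta>S by (simp add: deriv_start)
  have d2: "deriv (deriv start_c) (of_real \<theta>) \<noteq> 0"
  proof -
    define \<xi> where "\<xi> = complex_of_real \<theta>"
    have sp: "spiral (of_real b) \<xi> = 1" using \<theta> by (simp add: \<xi>_def)
    have s\<xi>: "sin \<xi> \<noteq> 0" using \<theta>S by (simp add: \<xi>_def)
    \<comment> \<open>The factor \<open>spiral (of_real b) z - 1\<close> vanishes at
      \<open>\<xi>\<close>, so only its own derivative survives in the quotient rule.\<close>
    have "((\<lambda>z. of_real c * ((spiral (of_real b) z - 1) / (sin z)\<^sup>2)) has_field_derivative
        of_real c * (- (1 + (of_real b)\<^sup>2) * exp (of_real b * \<xi>) * sin \<xi> / (sin \<xi>)\<^sup>2)) (at \<xi>)"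
      using s\<xi> by (auto intro!: derivative_eq_intros spiral_deriv simp: sp power2_eq_square)
    then have "(deriv start_c has_field_derivative
        of_real c * (- (1 + (of_real b)\<^sup>2) * exp (of_real b * \<xi>) * sin \<xi> / (sin \<xi>)\<^sup>2)) (at \<xi>)"
      by (rule has_field_derivative_transform_within_open[OF _ open_sin_nonzero])
        (use \<theta>S in \<open>auto simp: \<xi>_def deriv_start\<close>)
    then have "deriv (deriv start_c) \<xi> =
        of_real c * (- (1 + (of_real b)\<^sup>2) * exp (of_real b * \<xi>) * sin \<xi> / (sin \<xi>)\<^sup>2)"
      by (rule DERIV_imp_deriv)
    moreover have "1 + (complex_of_real b)\<^sup>2 \<noteq> 0"
    proof -
      have "1 + (complex_of_real b)\<^sup>2 = of_real (1 + b\<^sup>2)" by simp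
      then show ?thesis by (metis of_real_eq_0_iff add_pos_nonneg zero_less_one zero_le_power2 less_irrefl)
    qed
    moreover have "c \<noteq> 0" using c by simp
    ultimately show ?thesis
      unfolding \<xi>_def[symmetric] using s\<xi>
      by (auto simp only: mult_eq_0_iff divide_eq_0_iff neg_equal_0_iff_equal power_eq_0_iff
          of_real_eq_0_iff exp_not_eq_zero)
  qed
  obtain Q r where r: "r > 0" "Q holomorphic_on ball 0 r"
    and Q_real: "\<And>z. 0 \<le> z \<Longrightarrow> z < r \<Longrightarrow>
      \<exists>t. pi < t \<and> t \<le> \<theta> \<and> c * crossing b t = c * crossing b \<theta> + z\<^sup>2 \<and> Q (of_real z) = end_c (of_real t)"
    and Q: "\<And>z. z \<in> ball 0 r \<Longrightarrow>
      \<exists>x\<in>?S. start_c x = of_real (c * crossing b \<theta>) + z\<^sup>2 \<and> Q z = end_c x \<and>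
        deriv Q z * deriv start_c x = 2 * z * deriv end_c x \<and> (z \<noteq> 0 \<longrightarrow> deriv start_c x \<noteq> 0)"
    by (rule holomorphic_square_root_parametrization[OF holomorphic_start_end open_sin_nonzero,
          of pi \<theta> "\<lambda>t. c * crossing b t"])
      (use d1 d2 \<theta> start_end_of_real sin_of_real_nonzero start_decreasing in \<open>auto simp del: of_real_mult\<close>)
  \<comment> \<open>For \<open>z = 0\<close> strict monotonicity of the start point forces
    \<open>t = \<theta>\<close>, and that half-turn ends at the origin.\<close>
  have Q0: "Q 0 = 0"
  proof -
    obtain t where t: "pi < t" "t \<le> \<theta>" "c * crossing b t = c * crossing b \<theta>" "Q 0 = end_c (of_real t)"
      using Q_real[of 0] r by auto
    then have "t = \<theta>" using start_decreasing[of t \<theta>] by force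
    then show ?thesis using t(4) start_end_of_real(2)[of \<theta>] end_zero by simp
  qed
  show ?thesis
  proof (rule that[OF r])
    show "\<exists>t. pi < t \<and> t \<le> \<theta> \<and> c * crossing b t = yhat + z\<^sup>2 \<and>
      Q (of_real z) = of_real (- c * crossing (- b) t)" if "0 \<le> z" "z < r" for z
      using Q_real[OF that] by (simp add: yhat start_end_of_real del: of_real_mult of_real_minus)
    show "Q z * deriv Q z * (of_real D * (of_real yhat + z\<^sup>2)\<^sup>2 - of_real (a * T) * (of_real yhat + z\<^sup>2) + of_real (a\<^sup>2))
      = 2 * z * (of_real yhat + z\<^sup>2) * (of_real D * (Q z)\<^sup>2 - of_real (a * T) * Q z + of_real (a\<^sup>2))"
      (is "Q z * deriv Q z * ?Wx = 2 * z * ?x * ?Wy") if z: "z \<in> ball 0 r" for z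
    \<comment> \<open>For \<open>z \<noteq> 0\<close> the nonzero factor
      \<open>deriv start_c x\<close> is cancelled; at 0 both sides vanish.\<close>
    proof (cases "z = 0")
      case True
      then show ?thesis by (simp add: Q0)
    next
      case False
      then obtain x where x: "sin x \<noteq> 0" "start_c x = ?x" "Q z = end_c x"
          "deriv Q z * deriv start_c x = 2 * z * deriv end_c x" "deriv start_c x \<noteq> 0"
        using Q[OF z] yhat by auto
      have inv: "deriv end_c x * Q z * ?Wx = deriv start_c x * ?x * ?Wy"
        using invariant_c[OF x(1)] unfolding x(2) x(3)[symmetric] .
      have "Q z * deriv Q z * ?Wx * deriv start_c x = (deriv Q z * deriv start_c x) * (Q z * ?Wx)"
        by (simp only: mult_ac)
      also have "\<dots> = 2 * z * (deriv end_c x * Q z * ?Wx)"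
        unfolding x(4) by (simp only: mult_ac)
      also have "\<dots> = 2 * z * ?x * ?Wy * deriv start_c x"
        unfolding inv by (simp only: mult_ac)
      finally show ?thesis using x(5) by simp
    qed
  qed
qed

text \<open>For small real \<open>z \<ge> 0\<close>, \<open>Q z\<close> is the half-map at
  \<open>yhat + z\<^sup>2\<close>, so the real parts of the Taylor coefficients of \<open>Q\<close>
  are those of the expansion. The differential equation for \<open>Q\<close> determines the first
  ones.\<close>

lemma newton_puiseux:
  "\<exists>cf. has_newton_puiseux_half (left_poincare_map T D a) (left_poincare_dom T D a) yhat cf \<and>
     cf 0 = 0 \<and>
     cf 1 = a * sqrt (2 * yhat / W T D a yhat) \<and>
     cf 2 = - (a * T / 3) * (2 * yhat / W T D a yhat) \<and>
     cf 3 = a ^ 3 / 72 * ((9 * D + 2 * T\<^sup>2) / a\<^sup>2 + 9 / yhat\<^sup>2) * sqrt (2 * yhat / W T D a yhat) ^ 3"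
proof -
  obtain Q r where r: "r > 0" and hol: "Q holomorphic_on ball 0 r"
    and Q_real: "\<And>z. 0 \<le> z \<Longrightarrow> z < r \<Longrightarrow> \<exists>t. pi < t \<and> t \<le> \<theta> \<and> c * crossing b t = yhat + z\<^sup>2 \<and>
      Q (of_real z) = of_real (- c * crossing (- b) t)"
    and ode: "\<And>z. z \<in> ball 0 r \<Longrightarrow>
      Q z * deriv Q z * (of_real D * (of_real yhat + z\<^sup>2)\<^sup>2 - of_real (a * T) * (of_real yhat + z\<^sup>2) + of_real (a\<^sup>2))
      = 2 * z * (of_real yhat + z\<^sup>2) * (of_real D * (Q z)\<^sup>2 - of_real (a * T) * Q z + of_real (a\<^sup>2))"
    by (rule square_root_parametrization) blast
  define A where "A = fps_expansion Q 0"
  define cf where "cf n = Re (A $ n)" for n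
  have A_nth: "A $ n = (deriv ^^ n) Q 0 / fact n" for n
    by (simp add: A_def fps_expansion_def)
  have expansion: "has_newton_puiseux_half (left_poincare_map T D a) (left_poincare_dom T D a) yhat cf"
    unfolding has_newton_puiseux_half_def
  proof (intro exI[of _ "r\<^sup>2"] conjI ballI subsetI)
    fix y assume y: "y \<in> {yhat..<yhat + r\<^sup>2}"
    define z where "z = sqrt (y - yhat)"
    have z: "0 \<le> z" "z\<^sup>2 = y - yhat" using y by (auto simp: z_def)
    have "z < r" using y r real_sqrt_less_mono[of "y - yhat" "r\<^sup>2"] by (auto simp: z_def)
    obtain t where t: "pi < t" "t \<le> \<theta>" "c * crossing b t = y" "Q (of_real z) = of_real (- c * crossing (- b) t)"
      using Q_real[OF z(1) \<open>z < r\<close>] z(2) by auto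
    show "y \<in> left_poincare_dom T D a" using t by (auto simp: domain_eq)
    have "(\<lambda>n. cf n * z ^ n) sums Re (Q (of_real z))"
      using holomorphic_power_series_Re[of Q 0 r z] hol z(1) \<open>z < r\<close> by (simp add: cf_def A_nth)
    also have "Re (Q (of_real z)) = left_poincare_map T D a y"
      using map_eq[OF t(1,2)] t(3,4) by simp
    finally show "(\<lambda>n. cf n * sqrt (y - yhat) ^ n) sums left_poincare_map T D a y"
      by (simp add: z_def)
  qed (use r in auto)
  have Q0: "Q 0 = 0"
  proof -
    obtain t where t: "pi < t" "t \<le> \<theta>" "c * crossing b t = yhat" "Q 0 = of_real (- c * crossing (- b) t)"
      using Q_real[of 0] r by auto
    then have "t = \<theta>" using start_decreasing[of t \<theta>] yhat by force
    then show ?thesis using t(4) end_zero by simp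
  qed
  then have A0: "A $ 0 = 0" by (simp add: A_nth)
  have Q_exp: "Q has_fps_expansion A"
    unfolding A_def by (rule has_fps_expansion_fps_expansion[OF open_ball _ hol]) (use r in simp)
  \<comment> \<open>These are \<open>W\<close> and its derivative at \<open>yhat\<close>, so
    \<open>W\<close> at \<open>yhat + z\<^sup>2\<close> is
    \<open>w0 + w1 * z\<^sup>2 + D * z ^ 4\<close>.\<close>
  define w0 w1 where "w0 = W T D a yhat" and "w1 = 2 * D * yhat - a * T"
  have eq: "A * fps_deriv A * (fps_const (of_real w0) + fps_const (of_real w1) * fps_X ^ 2 + fps_const (of_real D) * fps_X ^ 4)
      = 2 * fps_X * (fps_const (of_real yhat) + fps_X ^ 2) *
        (fps_const (of_real D) * A ^ 2 - fps_const (of_real (a * T)) * A + fps_const ((of_real a) ^ 2))"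
  proof (rule fps_expansion_unique_complex)
    let ?L = "\<lambda>z. Q z * deriv Q z * (of_real w0 + of_real w1 * z ^ 2 + of_real D * z ^ 4)"
    let ?R = "\<lambda>z. 2 * z * (of_real yhat + z ^ 2) * (of_real D * (Q z) ^ 2 - of_real (a * T) * Q z + (of_real a) ^ 2)"
    show "?L has_fps_expansion (A * fps_deriv A * (fps_const (of_real w0) + fps_const (of_real w1) * fps_X ^ 2 + fps_const (of_real D) * fps_X ^ 4))"
      by (intro fps_expansion_intros Q_exp)
    have R: "?R has_fps_expansion (2 * fps_X * (fps_const (of_real yhat) + fps_X ^ 2) *
        (fps_const (of_real D) * A ^ 2 - fps_const (of_real (a * T)) * A + fps_const ((of_real a) ^ 2)))"
      by (intro fps_expansion_intros Q_exp)
    have "eventually (\<lambda>z. z \<in> ball 0 r) (nhds (0::complex))"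
      using r by (intro eventually_nhds_in_open) auto
    then have "eventually (\<lambda>z. ?L z = ?R z) (nhds 0)"
    proof eventually_elim
      case (elim z)
      have "of_real w0 + of_real w1 * z ^ 2 + of_real D * z ^ 4
        = of_real D * (of_real yhat + z\<^sup>2)\<^sup>2 - of_real (a * T) * (of_real yhat + z\<^sup>2) + of_real (a\<^sup>2)"
        by (simp add: w0_def w1_def W_def power2_eq_square power4_eq_xxxx algebra_simps)
      then show ?case using ode[OF elim] by simp
    qed
    then show "?L has_fps_expansion (2 * fps_X * (fps_const (of_real yhat) + fps_X ^ 2) *
        (fps_const (of_real D) * A ^ 2 - fps_const (of_real (a * T)) * A + fps_const ((of_real a) ^ 2)))"
      by (rule iffD2[OF has_fps_expansion_cong[OF _ refl] R])
  qed
  note coeffs = fps_puiseux_coeffs[OF eq A0]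
  define K s where "K = 2 * yhat / w0" and "s = sqrt K"
  have w0: "0 < w0" using W_pos by (simp add: w0_def)
  have K: "0 < K" "w0 * K = 2 * yhat" "s\<^sup>2 = K" "0 < s" using yhat_pos w0 by (auto simp: K_def s_def)
  have A1: "A $ 1 = of_real (a * s)"
  proof -
    have "w0 * (a * s)\<^sup>2 = 2 * yhat * a\<^sup>2"
      by (simp add: power_mult_distrib K(3) flip: K(2))
    then have "of_real w0 * (A $ 1)\<^sup>2 = complex_of_real (w0 * (a * s)\<^sup>2)"
      unfolding coeffs(1) by simp
    then have "of_real w0 * (A $ 1)\<^sup>2 = of_real w0 * (of_real (a * s))\<^sup>2"
      by (simp only: of_real_mult of_real_power)
    then have "(A $ 1)\<^sup>2 = (of_real (a * s))\<^sup>2" using w0 by simp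
    then consider "A $ 1 = of_real (a * s)" | "A $ 1 = - of_real (a * s)"
      using power2_eq_iff by blast
    \<comment> \<open>A positive slope would make \<open>Q\<close> positive for small positive
      arguments, but its values there are end points of half-turns, which are at most 0.\<close>
    moreover have "Re (A $ 1) \<le> 0"
    proof (rule ccontr)
      assume "\<not> Re (A $ 1) \<le> 0"
      have "(Q has_field_derivative A $ 1) (at (of_real 0))"
        using holomorphic_derivI[OF hol open_ball, of 0] r by (simp add: A_nth)
      then have "((\<lambda>x. Q (of_real x)) has_vector_derivative A $ 1) (at 0)"
        by (rule has_vector_derivative_real_field)
      from bounded_linear.has_vector_derivative[OF bounded_linear_Re this]
      have "((\<lambda>x. Re (Q (of_real x))) has_real_derivative Re (A $ 1)) (at 0)"
        by (simp add: has_real_derivative_iff_has_vector_derivative)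
      from DERIV_pos_inc_right[OF this] obtain d where
        d: "d > 0" "\<And>h. 0 < h \<Longrightarrow> h < d \<Longrightarrow> 0 < Re (Q (of_real h))"
        using \<open>\<not> Re (A $ 1) \<le> 0\<close> Q0 by auto
      define h where "h = min d r / 2"
      have h: "0 < h" "h < d" "h < r" using d(1) r by (auto simp: h_def)
      obtain t where t: "pi < t" "t \<le> \<theta>" "Q (of_real h) = of_real (- c * crossing (- b) t)"
        using Q_real[of h] h by auto
      have "- c * crossing (- b) t \<le> 0"
        using end_increasing[of t \<theta>] end_zero t \<theta> by (cases "t = \<theta>") auto
      then show False using d(2)[of h] h t(3) by simp
    qed
    ultimately show ?thesis using mult_neg_pos[OF a_neg K(4)] by cases auto
  qed
  have A2: "A $ 2 = of_real (- (a * T / 3) * K)"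
  proof -
    have "of_real (3 * w0 * (a * s)) * A $ 2 = of_real (- (2 * yhat * (a * T) * (a * s)))"
      using coeffs(2) unfolding A1 by (simp add: mult_ac)
    also have "2 * yhat * (a * T) * (a * s) = - (3 * w0 * (a * s) * (- (a * T / 3) * K))"
      unfolding K(2)[symmetric] by simp
    also have "complex_of_real (- (- (3 * w0 * (a * s) * (- (a * T / 3) * K))))
        = of_real (3 * w0 * (a * s)) * of_real (- (a * T / 3) * K)"
      by (simp only: minus_minus of_real_mult)
    finally show ?thesis using w0 a_neg K(4) by (simp only: mult_cancel_left of_real_eq_0_iff) simp
  qed
  have "complex_of_real (w0 * 4 * (a * s)) * A $ 3 = of_real (2 * a\<^sup>2 + 2 * yhat * (D * (a * s)\<^sup>2 - a * T * (- (a * T / 3) * K))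
      - w1 * (a * s)\<^sup>2 - w0 * 2 * (- (a * T / 3) * K)\<^sup>2)"
    using coeffs(3) unfolding A1 A2 by (simp add: algebra_simps)
  from arg_cong[OF this, of Re]
  have "w0 * 4 * (a * s) * cf 3 = 2 * a\<^sup>2 + 2 * yhat * (D * (a * s)\<^sup>2 - a * T * (- (a * T / 3) * K))
      - w1 * (a * s)\<^sup>2 - w0 * 2 * (- (a * T / 3) * K)\<^sup>2"
    by (simp only: cf_def Re_complex_of_real times_complex.sel Im_complex_of_real mult_zero_left diff_zero)
  then have "cf 3 = a ^ 3 / 72 * ((9 * D + 2 * T\<^sup>2) / a\<^sup>2 + 9 / yhat\<^sup>2) * s ^ 3"
    using yhat_pos a_neg
    by (intro third_coefficient[where w\<^sub>0 = w0 and K = K, OF K(3,1) _ _ K(2) _ refl refl])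
      (auto simp: w0_def W_def w1_def algebra_simps)
  then show ?thesis
    using expansion A0 A1 A2 unfolding s_def K_def w0_def by (intro exI[of _ cf]) (simp add: cf_def)
qed

end

theorem proposition3:
  fixes T D a yhat :: real and I :: "real set" and P :: "real \<Rightarrow> real"
  defines "I \<equiv> left_poincare_dom T D a"
    and "P \<equiv> left_poincare_map T D a"
  assumes "a\<^sup>2 + D\<^sup>2 \<noteq> 0"
    and "yhat > 0" and "yhat \<in> I" and "P yhat = 0"
  shows "a < 0 \<and> T < 0 \<and> 4 * D - T\<^sup>2 > 0 \<and>
    (is_interval I \<and> yhat \<in> I \<and> (\<forall>y\<in>I. yhat \<le> y)) \<and>
    (inj_on P I \<and> real_analytic_on (the_inv_into I P) (P ` I)) \<and>
    (\<exists>c. has_newton_puiseux_half P I yhat c \<and>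
       c 0 = 0 \<and>
       c 1 = a * sqrt (2 * yhat / W T D a yhat) \<and>
       c 2 = - (a * T / 3) * (2 * yhat / W T D a yhat) \<and>
       c 3 = a ^ 3 / 72 * ((9 * D + 2 * T\<^sup>2) / a\<^sup>2 + 9 / yhat\<^sup>2) *
               sqrt (2 * yhat / W T D a yhat) ^ 3) \<and>
    (\<lambda>y. P y -
       (a * sqrt (2 * yhat / W T D a yhat) * (y - yhat) powr (1 / 2)
        - a * T / 3 * (2 * yhat / W T D a yhat) * (y - yhat)
        + a ^ 3 / 72 * ((9 * D + 2 * T\<^sup>2) / a\<^sup>2 + 9 / yhat\<^sup>2) *
            sqrt (2 * yhat / W T D a yhat) ^ 3 * (y - yhat) powr (3 / 2)))
      \<in> O[at_right yhat](\<lambda>y. (y - yhat)\<^sup>2)"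
proof -
  obtain v where "left_poincare_graph T D a yhat v"
    using \<open>yhat \<in> I\<close> by (auto simp: I_def left_poincare_dom_def)
  \<comment> \<open>The extension clause concerns only the start 0 and is excluded by
    \<open>yhat > 0\<close>.\<close>
  then have "left_return T D a yhat v"
    using \<open>yhat > 0\<close> by (simp add: left_poincare_graph_def)
  then have ret: "left_return T D a yhat 0"
    using left_poincare_map_eq \<open>P yhat = 0\<close> by (fastforce simp: P_def)
  have signs: "a < 0" "T < 0" "T\<^sup>2 < 4 * D"
    using left_return_to_origin_signs[OF ret \<open>yhat > 0\<close>] by auto
  \<comment> \<open>The eigenvalues are \<open>- b * w\<close> plus or minus \<open>i * w\<close>,
    and the equilibrium \<open>x = a / D\<close> equals \<open>- c / w\<close>.\<close>
  define w b c where "w = sqrt (4 * D - T\<^sup>2) / 2" and "b = - T / (2 * w)" and "c = - a * w / D"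
  have "0 < D" using signs(3) zero_le_power2[of T] by linarith
  have w: "0 < w" and w_sq: "w\<^sup>2 = D - T\<^sup>2 / 4"
    using signs by (auto simp: w_def power_divide field_simps)
  have b: "0 < b" and c: "0 < c"
    using signs w \<open>0 < D\<close> by (simp_all add: b_def c_def divide_neg_pos mult_neg_pos)
  have T: "T = - 2 * b * w" using w by (simp add: b_def)
  have D: "D = w\<^sup>2 * (1 + b\<^sup>2)"
    using w w_sq by (simp add: b_def field_simps power2_eq_square)
  have a: "a = - c * w * (1 + b\<^sup>2)"
  proof -
    have "c * w * (1 + b\<^sup>2) * D = - a * (w\<^sup>2 * (1 + b\<^sup>2))"
      using \<open>0 < D\<close> by (simp add: c_def power2_eq_square)
    then have "c * w * (1 + b\<^sup>2) * D = - a * D" unfolding D[symmetric] .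
    then show ?thesis using \<open>0 < D\<close> unfolding mult_cancel_right by simp
  qed
  obtain \<theta> where \<theta>: "pi < \<theta>" "\<theta> < 2 * pi" and "- c * crossing (- b) \<theta> = 0" and yhat: "yhat = c * crossing b \<theta>"
    using ret unfolding T D a left_return_focus_iff[OF b w c] by auto
  then have "spiral b \<theta> = 1"
    using crossing_minus_nonneg_iff(2)[OF \<theta>, of b] c by simp
  note params = b w c T D a \<theta> this yhat
  have "\<forall>y\<in>I. yhat \<le> y"
    using start_ge_yhat[OF params] by (auto simp: I_def domain_eq[OF params])
  moreover obtain cf where cf: "has_newton_puiseux_half P I yhat cf" "cf 0 = 0"
    "cf 1 = a * sqrt (2 * yhat / W T D a yhat)"
    "cf 2 = - (a * T / 3) * (2 * yhat / W T D a yhat)"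
    "cf 3 = a ^ 3 / 72 * ((9 * D + 2 * T\<^sup>2) / a\<^sup>2 + 9 / yhat\<^sup>2) * sqrt (2 * yhat / W T D a yhat) ^ 3"
    using newton_puiseux[OF params] unfolding I_def P_def by blast
  moreover have "(\<lambda>y. P y -
       (cf 1 * (y - yhat) powr (1 / 2) + cf 2 * (y - yhat) + cf 3 * (y - yhat) powr (3 / 2)))
      \<in> O[at_right yhat](\<lambda>y. (y - yhat)\<^sup>2)"
  proof -
    \<comment> \<open>To the right of \<open>yhat\<close> the real powers coincide with powers of
      the square root.\<close>
    have "(\<Sum>n<4. cf n * sqrt (y - yhat) ^ n)
        = cf 1 * (y - yhat) powr (1 / 2) + cf 2 * (y - yhat) + cf 3 * (y - yhat) powr (3 / 2)"
      if "yhat < y" for y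
    proof -
      have "(y - yhat) powr (3 / 2) = ((y - yhat) powr (1 / 2)) powr (real 3)"
        by (simp add: powr_powr)
      also have "\<dots> = sqrt (y - yhat) ^ 3"
        using that by (subst powr_realpow) (auto simp: powr_half_sqrt)
      finally show ?thesis
        using that cf(2) by (simp add: powr_half_sqrt eval_nat_numeral)
    qed
    then have "eventually (\<lambda>y. P y - (\<Sum>n<4. cf n * sqrt (y - yhat) ^ n)
        = P y - (cf 1 * (y - yhat) powr (1 / 2) + cf 2 * (y - yhat) + cf 3 * (y - yhat) powr (3 / 2))) (at_right yhat)"
      by (auto simp: eventually_at_filter)
    then show ?thesis
      using newton_puiseux_remainder_bigo[OF cf(1)] by (rule landau_o.big.in_cong[THEN iffD1])
  qed
  then have "(\<lambda>y. P y -
       (a * sqrt (2 * yhat / W T D a yhat) * (y - yhat) powr (1 / 2)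
        - a * T / 3 * (2 * yhat / W T D a yhat) * (y - yhat)
        + a ^ 3 / 72 * ((9 * D + 2 * T\<^sup>2) / a\<^sup>2 + 9 / yhat\<^sup>2) *
            sqrt (2 * yhat / W T D a yhat) ^ 3 * (y - yhat) powr (3 / 2)))
      \<in> O[at_right yhat](\<lambda>y. (y - yhat)\<^sup>2)"
    unfolding cf(3-5) by simp
  ultimately show ?thesis
    using signs \<open>yhat \<in> I\<close> is_interval_domain[OF params] inj_on_map[OF params] real_analytic_inverse[OF params]
    unfolding I_def P_def by auto
qed

end
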